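(* (a) Let $\mathcal{C}$ be either the category $\mathsf{CompHaus}$ of compact Hausdorff spaces or the category $\mathsf{Profinite}$ of profinite spaces. A presheaf $X\colon \mathcal{C}^{\mathrm{op}}\to\mathsf{Set}$ is a sheaf for the coherent topology on $\mathcal{C}$ if and only if it satisfies the following two conditions: 1) $X$ preserves finite products: for every finite family $(T_i)_i$ of objects of $\mathcal{C}$, the natural map $X\bigl(\coprod_i T_i\bigr)\to\prod_i X(T_i)$ is a bijection. 2) For every surjection $\pi\colon S\to T$ in $\mathcal{C}$, the diagram $X(T)\xrightarrow{X(\pi)} X(S)\rightrightarrows X(S\times_T S)$ is an equalizer, where the two parallel maps are induced by the two projections $S\times_T S\to S$. (b) A presheaf $X\colon \mathsf{Stonean}^{\mathrm{op}}\to\mathsf{Set}$ on the category of Stonean spaces is a sheaf for the coherent topology on $\mathsf{Stonean}$ if and only if it preserves finite products: for every finite family $(T_i)_i$ of objects of $\mathsf{Stonean}$, the natural map $X\bigl(\coprod_i T_i\bigr)\to\prod_i X(T_i)$ is a bijection.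
   Context: $\mathsf{CompHaus}$ is the category of compact Hausdorff spaces and continuous maps. $\mathsf{Profinite}$ is its full subcategory of totally disconnected compact Hausdorff spaces. $\mathsf{Stonean}$ is the full subcategory of extremally disconnected compact Hausdorff spaces (the closure of every open set is open). A family of morphisms $(f_i\colon X_i\to B)_{i\in I}$ in a category is effective epimorphic if for every object $W$ and every family $(e_i\colon X_i\to W)_{i\in I}$ such that $e_i\circ g_i=e_j\circ g_j$ whenever $i,j\in I$, $g_i\colon Z\to X_i$, $g_j\colon Z\to X_j$ satisfy $f_i\circ g_i=f_j\circ g_j$, there is a unique $d\colon B\to W$ with $d\circ f_i=e_i$ for all $i$. A category is precoherent if for every finite effective epimorphic family $(\pi_i\colon X_i\to B)_{i\in I}$ and every morphism $f\colon B'\to B$ there is a finite effective epimorphic family $(\pi'_j\colon X'_j\to B')_{j\in J}$ such that each $f\circ\pi'_j$ factors through some $\pi_i$. The coherent topology on a precoherent category is the smallest Grothendieck topology in which the sieve generated by each finite effective epimorphic family is a covering sieve. The three categories above are precoherent, so they carry a coherent topology. Size convention: "set" is understood relative to a sufficiently large universe. *)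

theory Defs
  imports "HOL-Analysis.Analysis"
begin

section \<open>Categories, presheaves and Grothendieck topologies\<close>

record ('o, 'm) category_data =
  Obj :: "'o set"
  Arr :: "'m set"
  Dom :: "'m \<Rightarrow> 'o"
  Cod :: "'m \<Rightarrow> 'o"
  Ident :: "'o \<Rightarrow> 'm"
  Cmp :: "'m \<Rightarrow> 'm \<Rightarrow> 'm"  (* Cmp C g f is g after f *)

definition hom_set :: "('o, 'm) category_data \<Rightarrow> 'o \<Rightarrow> 'o \<Rightarrow> 'm set" where
  "hom_set C A B = {f \<in> Arr C. Dom C f = A \<and> Cod C f = B}"

definition is_category :: "('o, 'm) category_data \<Rightarrow> bool" where
  "is_category C \<longleftrightarrow>
     (\<forall>f\<in>Arr C. Dom C f \<in> Obj C \<and> Cod C f \<in> Obj C) \<and>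
     (\<forall>A\<in>Obj C. Ident C A \<in> hom_set C A A) \<and>
     (\<forall>f\<in>Arr C. \<forall>g\<in>Arr C. Dom C g = Cod C f \<longrightarrow>
        Cmp C g f \<in> hom_set C (Dom C f) (Cod C g)) \<and>
     (\<forall>f\<in>Arr C. Cmp C f (Ident C (Dom C f)) = f \<and> Cmp C (Ident C (Cod C f)) f = f) \<and>
     (\<forall>f\<in>Arr C. \<forall>g\<in>Arr C. \<forall>h\<in>Arr C. Dom C g = Cod C f \<and> Dom C h = Cod C g \<longrightarrow>
        Cmp C h (Cmp C g f) = Cmp C (Cmp C h g) f)"

text \<open>The base object \<open>B\<close> is an argument because the family may be empty.\<close>

definition effective_epi_family ::
  "('o, 'm) category_data \<Rightarrow> 'i set \<Rightarrow> ('i \<Rightarrow> 'm) \<Rightarrow> 'o \<Rightarrow> bool" where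
  "effective_epi_family C I f B \<longleftrightarrow>
     B \<in> Obj C \<and>
     (\<forall>i\<in>I. f i \<in> Arr C \<and> Cod C (f i) = B) \<and>
     (\<forall>W\<in>Obj C. \<forall>e.
        (\<forall>i\<in>I. e i \<in> hom_set C (Dom C (f i)) W) \<and>
        (\<forall>i\<in>I. \<forall>j\<in>I. \<forall>Z\<in>Obj C.
           \<forall>g\<in>hom_set C Z (Dom C (f i)). \<forall>h\<in>hom_set C Z (Dom C (f j)).
             Cmp C (f i) g = Cmp C (f j) h \<longrightarrow> Cmp C (e i) g = Cmp C (e j) h)
        \<longrightarrow> (\<exists>!d. d \<in> hom_set C B W \<and> (\<forall>i\<in>I. Cmp C d (f i) = e i)))"

definition is_sieve :: "('o, 'm) category_data \<Rightarrow> 'o \<Rightarrow> 'm set \<Rightarrow> bool" where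
  "is_sieve C B S \<longleftrightarrow>
     S \<subseteq> {f \<in> Arr C. Cod C f = B} \<and>
     (\<forall>f\<in>S. \<forall>g\<in>Arr C. Cod C g = Dom C f \<longrightarrow> Cmp C f g \<in> S)"

definition max_sieve :: "('o, 'm) category_data \<Rightarrow> 'o \<Rightarrow> 'm set" where
  "max_sieve C B = {f \<in> Arr C. Cod C f = B}"

definition pullback_sieve :: "('o, 'm) category_data \<Rightarrow> 'm \<Rightarrow> 'm set \<Rightarrow> 'm set" where
  "pullback_sieve C f S = {g \<in> Arr C. Cod C g = Dom C f \<and> Cmp C f g \<in> S}"

definition generated_sieve ::
  "('o, 'm) category_data \<Rightarrow> 'i set \<Rightarrow> ('i \<Rightarrow> 'm) \<Rightarrow> 'm set" where
  "generated_sieve C I f = {Cmp C (f i) g | i g. i \<in> I \<and> g \<in> Arr C \<and> Cod C g = Dom C (f i)}"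

definition grothendieck_topology ::
  "('o, 'm) category_data \<Rightarrow> ('o \<Rightarrow> 'm set set) \<Rightarrow> bool" where
  "grothendieck_topology C J \<longleftrightarrow>
     (\<forall>B\<in>Obj C. \<forall>S\<in>J B. is_sieve C B S) \<and>
     (\<forall>B\<in>Obj C. max_sieve C B \<in> J B) \<and>
     (\<forall>B\<in>Obj C. \<forall>S\<in>J B. \<forall>f\<in>Arr C. Cod C f = B \<longrightarrow> pullback_sieve C f S \<in> J (Dom C f)) \<and>
     (\<forall>B\<in>Obj C. \<forall>S\<in>J B. \<forall>R. is_sieve C B R \<and>
        (\<forall>f\<in>S. pullback_sieve C f R \<in> J (Dom C f)) \<longrightarrow> R \<in> J B)"

text \<open>
  Finite families are indexed by finite sets of natural numbers, without loss of generality.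
  The smallest topology is the intersection of all topologies with the required coverings
  (see \<open>coherent_topology_least\<close> below); this makes sense in any category.
\<close>

definition contains_finite_effective_epis ::
  "('o, 'm) category_data \<Rightarrow> ('o \<Rightarrow> 'm set set) \<Rightarrow> bool" where
  "contains_finite_effective_epis C J \<longleftrightarrow>
     (\<forall>(I::nat set) f B. finite I \<and> effective_epi_family C I f B \<longrightarrow> generated_sieve C I f \<in> J B)"

definition coherent_topology :: "('o, 'm) category_data \<Rightarrow> 'o \<Rightarrow> 'm set set" where
  "coherent_topology C B =
     {S. \<forall>J. grothendieck_topology C J \<and> contains_finite_effective_epis C J \<longrightarrow> S \<in> J B}"

text \<open>Contravariant functors to sets; the values are subsets of the type \<open>'b\<close>.\<close>

record ('o, 'm, 'b) presheaf_data =
  Sec :: "'o \<Rightarrow> 'b set"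
  Res :: "'m \<Rightarrow> 'b \<Rightarrow> 'b"

definition is_presheaf ::
  "('o, 'm) category_data \<Rightarrow> ('o, 'm, 'b) presheaf_data \<Rightarrow> bool" where
  "is_presheaf C X \<longleftrightarrow>
     (\<forall>f\<in>Arr C. Res X f \<in> Sec X (Cod C f) \<rightarrow> Sec X (Dom C f)) \<and>
     (\<forall>A\<in>Obj C. \<forall>x\<in>Sec X A. Res X (Ident C A) x = x) \<and>
     (\<forall>f\<in>Arr C. \<forall>g\<in>Arr C. Dom C g = Cod C f \<longrightarrow>
        (\<forall>x\<in>Sec X (Cod C g). Res X (Cmp C g f) x = Res X f (Res X g x)))"

definition is_sheaf ::
  "('o, 'm) category_data \<Rightarrow> ('o \<Rightarrow> 'm set set) \<Rightarrow> ('o, 'm, 'b) presheaf_data \<Rightarrow> bool" where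
  "is_sheaf C J X \<longleftrightarrow>
     (\<forall>B\<in>Obj C. \<forall>S\<in>J B. \<forall>x.
        (\<forall>f\<in>S. x f \<in> Sec X (Dom C f)) \<and>
        (\<forall>f\<in>S. \<forall>g\<in>Arr C. Cod C g = Dom C f \<longrightarrow> Res X g (x f) = x (Cmp C f g))
        \<longrightarrow> (\<exists>!s. s \<in> Sec X B \<and> (\<forall>f\<in>S. Res X f s = x f)))"

definition is_coproduct ::
  "('o, 'm) category_data \<Rightarrow> 'i set \<Rightarrow> ('i \<Rightarrow> 'o) \<Rightarrow> 'o \<Rightarrow> ('i \<Rightarrow> 'm) \<Rightarrow> bool" where
  "is_coproduct C I T P \<iota> \<longleftrightarrow>
     P \<in> Obj C \<and>
     (\<forall>i\<in>I. \<iota> i \<in> hom_set C (T i) P) \<and>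
     (\<forall>W\<in>Obj C. \<forall>e. (\<forall>i\<in>I. e i \<in> hom_set C (T i) W) \<longrightarrow>
        (\<exists>!d. d \<in> hom_set C P W \<and> (\<forall>i\<in>I. Cmp C d (\<iota> i) = e i)))"

definition is_pullback ::
  "('o, 'm) category_data \<Rightarrow> 'm \<Rightarrow> 'm \<Rightarrow> 'o \<Rightarrow> 'm \<Rightarrow> 'm \<Rightarrow> bool" where
  "is_pullback C f g P p q \<longleftrightarrow>
     P \<in> Obj C \<and> p \<in> hom_set C P (Dom C f) \<and> q \<in> hom_set C P (Dom C g) \<and>
     Cmp C f p = Cmp C g q \<and>
     (\<forall>Z\<in>Obj C. \<forall>u\<in>hom_set C Z (Dom C f). \<forall>v\<in>hom_set C Z (Dom C g).
        Cmp C f u = Cmp C g v \<longrightarrow>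
        (\<exists>!d. d \<in> hom_set C Z P \<and> Cmp C p d = u \<and> Cmp C q d = v))"

text \<open>
  Coproducts and fibre products are determined up to isomorphism only, so the two conditions
  on a presheaf range over all choices of them. In the categories of spaces below, with an
  infinite type of points, finite coproducts exist, and so do fibre products of compact Hausdorff
  and of profinite spaces.
\<close>

definition preserves_finite_products ::
  "('o, 'm) category_data \<Rightarrow> ('o, 'm, 'b) presheaf_data \<Rightarrow> bool" where
  "preserves_finite_products C X \<longleftrightarrow>
     (\<forall>(I::nat set) T P \<iota>. finite I \<and> (\<forall>i\<in>I. T i \<in> Obj C) \<and> is_coproduct C I T P \<iota> \<longrightarrow>
        bij_betw (\<lambda>x. \<lambda>i\<in>I. Res X (\<iota> i) x) (Sec X P) (\<Pi>\<^sub>E i\<in>I. Sec X (T i)))"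

definition is_set_equalizer ::
  "'a set \<Rightarrow> ('a \<Rightarrow> 'b) \<Rightarrow> 'b set \<Rightarrow> ('b \<Rightarrow> 'c) \<Rightarrow> ('b \<Rightarrow> 'c) \<Rightarrow> bool" where
  "is_set_equalizer E e A u v \<longleftrightarrow> bij_betw e E {x \<in> A. u x = v x}"


section \<open>Categories of topological spaces\<close>

text \<open>
  Objects are topological spaces whose points lie in the type \<open>'a\<close>, which plays the role of the
  universe. A map carries its source and target, and its underlying function is taken to be
  \<open>undefined\<close> outside the source, so that equality of maps is equality of functions on the source.
\<close>

datatype 'a tmap = TMap (tdom: "'a topology") (tcod: "'a topology") (tfun: "'a \<Rightarrow> 'a")

definition full_Top :: "'a topology set \<Rightarrow> ('a topology, 'a tmap) category_data" where
  "full_Top K =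
     \<lparr> Obj = K,
       Arr = {m. tdom m \<in> K \<and> tcod m \<in> K \<and> continuous_map (tdom m) (tcod m) (tfun m) \<and>
                 tfun m \<in> extensional (topspace (tdom m))},
       Dom = tdom,
       Cod = tcod,
       Ident = (\<lambda>T. TMap T T (\<lambda>x\<in>topspace T. x)),
       Cmp = (\<lambda>g f. TMap (tdom f) (tcod g) (compose (topspace (tdom f)) (tfun g) (tfun f))) \<rparr>"

definition totally_disconnected :: "'a topology \<Rightarrow> bool" where
  "totally_disconnected T \<longleftrightarrow> (\<forall>S. connectedin T S \<longrightarrow> (\<exists>a. S \<subseteq> {a}))"

definition extremally_disconnected :: "'a topology \<Rightarrow> bool" where
  "extremally_disconnected T \<longleftrightarrow> (\<forall>U. openin T U \<longrightarrow> openin T (T closure_of U))"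

definition CompHaus :: "('a topology, 'a tmap) category_data" where
  "CompHaus = full_Top {T. compact_space T \<and> Hausdorff_space T}"

definition Profinite :: "('a topology, 'a tmap) category_data" where
  "Profinite = full_Top {T. compact_space T \<and> Hausdorff_space T \<and> totally_disconnected T}"

definition Stonean :: "('a topology, 'a tmap) category_data" where
  "Stonean = full_Top {T. compact_space T \<and> Hausdorff_space T \<and> extremally_disconnected T}"

definition surjection :: "'a tmap \<Rightarrow> bool" where
  "surjection m \<longleftrightarrow> tfun m ` topspace (tdom m) = topspace (tcod m)"

definition surjections_give_equalizers ::
  "('a topology, 'a tmap) category_data \<Rightarrow> ('a topology, 'a tmap, 'b) presheaf_data \<Rightarrow> bool" where
  "surjections_give_equalizers C X \<longleftrightarrow>
     (\<forall>\<pi>\<in>Arr C. surjection \<pi> \<longrightarrow>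
        (\<forall>P p q. is_pullback C \<pi> \<pi> P p q \<longrightarrow>
           is_set_equalizer (Sec X (Cod C \<pi>)) (Res X \<pi>) (Sec X (Dom C \<pi>)) (Res X p) (Res X q)))"


section \<open>Well-definedness\<close>

lemma is_category_full_Top: "is_category (full_Top K)"
proof -
  have id: "continuous_map T T (\<lambda>x\<in>topspace T. x)" for T :: "'a topology"
    by (rule continuous_map_eq[OF continuous_map_id]) auto
  have comp: "continuous_map S U (compose (topspace S) g f)"
    if "continuous_map S T f" "continuous_map T U g" for S T U :: "'a topology" and f g
    by (rule continuous_map_eq[OF continuous_map_compose[OF that]]) (auto simp: compose_def)
  show ?thesis
    unfolding is_category_def hom_set_def full_Top_def
  proof (simp, intro conjI ballI allI impI, goal_cases)
    case (2 f)
    then show ?case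
      by (cases f) (auto simp: compose_def fun_eq_iff extensional_def)
  next
    case (3 f)
    then show ?case
      by (cases f)
        (auto simp: compose_def fun_eq_iff extensional_def Pi_iff dest!: continuous_map_funspace)
  next
    case (4 f g h)
    then show ?case
      by (auto simp: compose_def fun_eq_iff Pi_iff dest!: continuous_map_funspace)
  qed (auto simp: id comp)
qed

lemma grothendieck_topology_coherent_topology:
  assumes "is_category C"
  shows "grothendieck_topology C (coherent_topology C)"
proof -
  let ?A = "\<lambda>B. {S. is_sieve C B S}"
  have cmp: "Cmp C g f \<in> Arr C" "Dom C (Cmp C g f) = Dom C f" "Cod C (Cmp C g f) = Cod C g"
    if "f \<in> Arr C" "g \<in> Arr C" "Dom C g = Cod C f" for f g
    using assms that by (auto simp: is_category_def hom_set_def)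
  have assoc: "Cmp C h (Cmp C g f) = Cmp C (Cmp C h g) f"
    if "f \<in> Arr C" "g \<in> Arr C" "h \<in> Arr C" "Dom C g = Cod C f" "Dom C h = Cod C g" for f g h
    using assms that by (simp add: is_category_def)
  have pull: "is_sieve C (Dom C f) (pullback_sieve C f S)"
    if "is_sieve C (Cod C f) S" "f \<in> Arr C" for f S
    unfolding is_sieve_def pullback_sieve_def
  proof (intro conjI ballI impI subsetI)
    fix h k
    assume h: "h \<in> {g \<in> Arr C. Cod C g = Dom C f \<and> Cmp C f g \<in> S}"
      and k: "k \<in> Arr C" "Cod C k = Dom C h"
    then have "Cmp C (Cmp C f h) k \<in> S"
      using that by (simp add: is_sieve_def cmp)
    with h k that show "Cmp C h k \<in> {g \<in> Arr C. Cod C g = Dom C f \<and> Cmp C f g \<in> S}"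
      by (simp add: cmp assoc)
  qed auto
  have "grothendieck_topology C ?A"
    unfolding grothendieck_topology_def
    using pull by (auto simp: is_sieve_def max_sieve_def cmp)
  moreover have "contains_finite_effective_epis C ?A"
    unfolding contains_finite_effective_epis_def
  proof (clarify)
    fix I :: "nat set" and f B
    assume f: "effective_epi_family C I f B"
    show "is_sieve C B (generated_sieve C I f)"
      unfolding is_sieve_def
    proof (intro conjI ballI impI)
      show "generated_sieve C I f \<subseteq> {f \<in> Arr C. Cod C f = B}"
        using f by (auto simp: generated_sieve_def effective_epi_family_def cmp)
    next
      fix h k
      assume h: "h \<in> generated_sieve C I f" and k: "k \<in> Arr C" "Cod C k = Dom C h"
      from h obtain i g where ig: "h = Cmp C (f i) g" "i \<in> I" "g \<in> Arr C" "Cod C g = Dom C (f i)"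
        by (auto simp: generated_sieve_def)
      have fi: "f i \<in> Arr C"
        using f ig by (auto simp: effective_epi_family_def)
      have "Cmp C h k = Cmp C (f i) (Cmp C g k)"
        using fi ig k by (simp add: assoc cmp)
      moreover have "Cmp C g k \<in> Arr C" "Cod C (Cmp C g k) = Dom C (f i)"
        using fi ig k by (auto simp: cmp)
      ultimately show "Cmp C h k \<in> generated_sieve C I f"
        using ig by (auto simp: generated_sieve_def)
    qed
  qed
  ultimately have sieve: "is_sieve C B S" if "S \<in> coherent_topology C B" for B S
    using that unfolding coherent_topology_def by blast
  show ?thesis
    unfolding grothendieck_topology_def
  proof (intro conjI ballI allI impI)
    fix B S assume "S \<in> coherent_topology C B"
    then show "is_sieve C B S" by (rule sieve)
  next
    fix B assume "B \<in> Obj C"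
    then show "max_sieve C B \<in> coherent_topology C B"
      by (simp add: coherent_topology_def grothendieck_topology_def)
  next
    fix B S f
    assume B: "B \<in> Obj C" and S: "S \<in> coherent_topology C B" and f: "f \<in> Arr C" "Cod C f = B"
    show "pullback_sieve C f S \<in> coherent_topology C (Dom C f)"
      unfolding coherent_topology_def
    proof (clarify)
      fix J assume J: "grothendieck_topology C J" "contains_finite_effective_epis C J"
      then have "S \<in> J B"
        using S by (auto simp: coherent_topology_def)
      with B f J(1) show "pullback_sieve C f S \<in> J (Dom C f)"
        unfolding grothendieck_topology_def by blast
    qed
  next
    fix B S R
    assume B: "B \<in> Obj C" and S: "S \<in> coherent_topology C B"
      and R: "is_sieve C B R \<and> (\<forall>f\<in>S. pullback_sieve C f R \<in> coherent_topology C (Dom C f))"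
    show "R \<in> coherent_topology C B"
      unfolding coherent_topology_def
    proof (clarify)
      fix J assume J: "grothendieck_topology C J" "contains_finite_effective_epis C J"
      then have "S \<in> J B" "\<forall>f\<in>S. pullback_sieve C f R \<in> J (Dom C f)"
        using S R by (auto simp: coherent_topology_def)
      with B R J(1) show "R \<in> J B"
        unfolding grothendieck_topology_def by blast
    qed
  qed
qed

lemma coherent_topology_least:
  shows "contains_finite_effective_epis C (coherent_topology C)"
    and "\<lbrakk>grothendieck_topology C J; contains_finite_effective_epis C J\<rbrakk>
           \<Longrightarrow> coherent_topology C B \<subseteq> J B"
  by (auto simp: contains_finite_effective_epis_def coherent_topology_def)

end

theory Submission
  imports Defs
begin

text \<open>
In each of the three categories a finite family of maps into \<open>B\<close> is effective epimorphic if and only if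
  it is jointly surjective (\<open>effective_epi_family_iff\<close>). If the images cover \<open>B\<close>, compatible
  maps on the members descend to a function on \<open>B\<close>, as compatibility on one-point test objects shows, and
  that function is continuous because maps of compact Hausdorff spaces are closed and the family is finite. If the
  union of the images, which is closed, misses a point \<open>b\<close>, then two maps out of \<open>B\<close> agree
  on this union and differ at \<open>b\<close>, so descent is not unique.

  Finite jointly surjective families can be refined along every map into their target. Hence the sieves that contain
  such a family form a Grothendieck topology, and every coherent covering sieve is one of them
  (\<open>coherent_topology_subset\<close>).

  A sheaf satisfies the conditions because the inclusions into a finite coproduct, and a single surjection, are
  effective epimorphic families. Compatibility over the inclusions is automatic: they are injective with disjoint
  images, and the sections over the empty space form a singleton since the empty family covers it. Compatibility over
  a surjection is the equalizer condition.

  Conversely, let sections be given compatibly on a sieve containing a finite jointly surjective family. For compact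
  Hausdorff and for profinite spaces, the family is the composition of the inclusions into the coproduct of its
  sources with one surjection onto \<open>B\<close>. The product condition glues the sections on the coproduct, and
  the equalizer condition descends the result to \<open>B\<close>
  (\<open>is_sheaf_if_products_and_equalizers\<close>). For Stonean spaces, a surjection from a compact Hausdorff
  space onto an extremally disconnected one has a section (\<open>extremally_disconnected_section\<close>, a theorem
  of Gleason). So the family is refined by a partition of \<open>B\<close> into clopen pieces, which exhibits
  \<open>B\<close> as a coproduct, and the product condition is enough (\<open>is_sheaf_if_products\<close>).

  The points of all spaces lie in one infinite type. Fibre products and finite coproducts therefore have to be carried
  back to that type along an injection of \<open>'a \<times> 'a\<close> or \<open>nat \<times> 'a\<close> into
  \<open>'a\<close>.
\<close>

section \<open>Compact Hausdorff spaces\<close>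

text \<open>Choose a closed set \<open>A\<close> that is minimal among those mapped onto \<open>T\<close>. By minimality, the
  image of a relatively open set \<open>G\<close> lies in the closure of the open set of those points of \<open>T\<close>
  whose whole fibre in \<open>A\<close> lies in \<open>G\<close>. Disjoint sets \<open>G\<close> give disjoint open sets, and these have
  disjoint closures in an extremally disconnected space, so \<open>p\<close> is injective on \<open>A\<close>. A continuous
  bijection of compact Hausdorff spaces is a homeomorphism, and its inverse is the section.\<close>

lemma extremally_disconnected_section:
  fixes S :: "'s topology" and T :: "'t topology"
  assumes S: "compact_space S" "Hausdorff_space S"
    and T: "Hausdorff_space T" "extremally_disconnected T"
    and p: "continuous_map S T p" "p ` topspace S = topspace T"
  obtains s where "continuous_map T S s" "\<And>t. t \<in> topspace T \<Longrightarrow> p (s t) = t"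
proof -
  \<comment> \<open>Zorn's lemma is applied to the complements, where a chain has its union as upper bound.\<close>
  define \<U> where "\<U> = {U. openin S U \<and> p ` (topspace S - U) = topspace T}"
  have "\<exists>M\<in>\<U>. \<forall>X\<in>\<U>. M \<subseteq> X \<longrightarrow> X = M"
  proof (rule subset_Zorn')
    fix C assume C: "subset.chain \<U> C"
    show "\<Union>C \<in> \<U>"
      unfolding \<U>_def
    proof (intro CollectI conjI)
      have open_C: "openin S U" if "U \<in> C" for U
        using C that by (auto simp: subset.chain_def \<U>_def)
      then show "openin S (\<Union>C)" by auto
      show "p ` (topspace S - \<Union>C) = topspace T"
      proof
        show "p ` (topspace S - \<Union>C) \<subseteq> topspace T" using p by auto
        show "topspace T \<subseteq> p ` (topspace S - \<Union>C)"
        proof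
          fix t assume t: "t \<in> topspace T"
          define F where "F = {x \<in> topspace S. p x \<in> {t}}"
          have "closedin S F" unfolding F_def
            using T t p by (intro closedin_continuous_map_preimage) (auto simp: closedin_Hausdorff_sing_eq)
          then have F: "compactin S F" using S closedin_compact_space by blast
          \<comment> \<open>The fibre is compact: if the chain covered it, a single member of the chain would.\<close>
          have "\<not> F \<subseteq> \<Union>C"
          proof
            assume "F \<subseteq> \<Union>C"
            then obtain D where D: "finite D" "D \<subseteq> C" "F \<subseteq> \<Union>D"
              using compactinD[OF F, of C] open_C by blast
            have "t \<in> p ` topspace S" using t p(2) by simp
            then have "F \<noteq> {}" unfolding F_def by blast
            then have "D \<noteq> {}" using D by auto
            moreover have "subset.chain \<U> D" using C D(2) unfolding subset.chain_def by (meson subsetD subset_trans)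
            ultimately have "\<Union>D \<in> D" using D(1) by (intro Union_in_chain)
            then have "\<Union>D \<in> \<U>" using C D(2) unfolding subset.chain_def by (meson subsetD)
            then have "t \<in> p ` (topspace S - \<Union>D)" using t by (simp add: \<U>_def)
            then show False using D(3) by (auto simp: F_def)
          qed
          then show "t \<in> p ` (topspace S - \<Union>C)" by (auto simp: F_def)
        qed
      qed
    qed
  qed
  then obtain M where M: "M \<in> \<U>" and max: "\<And>X. X \<in> \<U> \<Longrightarrow> M \<subseteq> X \<Longrightarrow> X = M" by blast
  define A where "A = topspace S - M"
  have A: "closedin S A" "p ` A = topspace T" "A \<subseteq> topspace S"
    using M by (auto simp: A_def \<U>_def)
  \<comment> \<open>Removing from \<open>A\<close> the part of \<open>G\<close> over a neighbourhood \<open>N\<close> of \<open>p x\<close> makes it miss a point of \<open>N\<close>.\<close>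
  have dense: "p x \<in> T closure_of (topspace T - p ` (A - G))"
    if G: "openin S G" and x: "x \<in> A" "x \<in> G" for G x
    unfolding in_closure_of
  proof (intro conjI allI impI)
    show "p x \<in> topspace T" using A x by auto
    fix N assume N: "p x \<in> N \<and> openin T N"
    define H where "H = G \<inter> {y \<in> topspace S. p y \<in> N}"
    have H: "openin S H" unfolding H_def
      using G N p by (intro openin_Int openin_continuous_map_preimage) auto
    have "p ` (A - H) \<noteq> topspace T"
    proof
      assume "p ` (A - H) = topspace T"
      moreover have "A - H = topspace S - (M \<union> H)" by (auto simp: A_def)
      ultimately have "M \<union> H \<in> \<U>" using H M by (auto simp: \<U>_def)
      then have "H \<subseteq> M" using max by blast
      then show False using x N A by (auto simp: H_def A_def)
    qed
    moreover have "p ` (A - H) \<subseteq> topspace T" using A by auto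
    ultimately obtain t where t: "t \<in> topspace T" "t \<notin> p ` (A - H)" by blast
    have "t \<in> p ` A" using t(1) A(2) by simp
    then obtain a where a: "a \<in> A" "p a = t" by blast
    then have "t \<in> N" using t by (auto simp: H_def)
    moreover have "t \<notin> p ` (A - G)" using t by (auto simp: H_def)
    ultimately show "\<exists>y. y \<in> topspace T - p ` (A - G) \<and> y \<in> N" using t by auto
  qed
  have closed_image: "closedin T (p ` K)" if "closedin S K" for K
    using that S T p continuous_imp_closed_map by (metis closed_map_def)
  have inj: "inj_on p A"
  proof (rule inj_onI, rule ccontr)
    fix x y assume xy: "x \<in> A" "y \<in> A" "p x = p y" "x \<noteq> y"
    then obtain G H where GH: "openin S G" "openin S H" "x \<in> G" "y \<in> H" "disjnt G H"
      using S(2) A(3) unfolding Hausdorff_space_def by (meson subsetD)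
    define U V where "U = topspace T - p ` (A - G)" and "V = topspace T - p ` (A - H)"
    have UV: "openin T U" "openin T V"
      unfolding U_def V_def using A GH by (auto intro!: openin_diff closed_image)
    have "U \<inter> V = {}"
    proof -
      have False if "t \<in> U" "t \<in> V" for t
      proof -
        have "t \<in> p ` A" using that(1) A(2) by (simp add: U_def)
        then obtain a where "a \<in> A" "p a = t" by blast
        then show False using that GH by (auto simp: U_def V_def disjnt_iff)
      qed
      then show ?thesis by blast
    qed
    then have "T closure_of U \<inter> V = {}"
      using UV by (simp add: openin_Int_closure_of_eq_empty Int_commute)
    then have "T closure_of U \<inter> T closure_of V = {}"
      using T(2) UV by (auto simp: extremally_disconnected_def openin_Int_closure_of_eq_empty)
    moreover have "p x \<in> T closure_of U" "p y \<in> T closure_of V"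
      unfolding U_def V_def using GH xy(1,2) by (blast intro: dense)+
    ultimately show False using xy(3) by auto
  qed
  have cA: "compact_space (subtopology S A)"
    using S A closedin_compact_space compact_space_subtopology by blast
  have tA: "topspace (subtopology S A) = A" using A by auto
  have pA: "continuous_map (subtopology S A) T p"
    using p continuous_map_from_subtopology by blast
  have "homeomorphic_map (subtopology S A) T p"
  proof (rule bijective_closed_imp_homeomorphic_map)
    show "closed_map (subtopology S A) T p"
      using cA T pA by (intro continuous_imp_closed_map)
  qed (use pA A tA inj in auto)
  then obtain s where s: "homeomorphic_maps (subtopology S A) T p s"
    using homeomorphic_map_maps by blast
  show ?thesis
  proof
    show "continuous_map T S s"
      using s unfolding homeomorphic_maps_def by (auto simp: continuous_map_in_subtopology)
    show "p (s t) = t" if "t \<in> topspace T" for t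
      using s that unfolding homeomorphic_maps_def by auto
  qed
qed

lemma compact_space_sum_topology:
  assumes "finite I" "\<And>i. i \<in> I \<Longrightarrow> compact_space (X i)"
  shows "compact_space (sum_topology X I)"
proof -
  have "compactin (sum_topology X I) (\<Union>i\<in>I. (\<lambda>x. (i, x)) ` topspace (X i))"
  proof (intro compactin_Union)
    show "compactin (sum_topology X I) K" if "K \<in> (\<lambda>i. (\<lambda>x. (i, x)) ` topspace (X i)) ` I" for K
      using that assms(2) by (auto simp: compact_space_def intro!: image_compactin continuous_map_component_injection)
  qed (use assms in auto)
  moreover have "(\<Union>i\<in>I. (\<lambda>x. (i, x)) ` topspace (X i)) = topspace (sum_topology X I)"
    by auto
  ultimately show ?thesis by (simp add: compact_space_def)
qed

lemma Hausdorff_space_sum_topology: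
  assumes "\<And>i. i \<in> I \<Longrightarrow> Hausdorff_space (X i)"
  shows "Hausdorff_space (sum_topology X I)"
  unfolding Hausdorff_space_def
proof (intro allI impI)
  fix u v assume uv: "u \<in> topspace (sum_topology X I) \<and> v \<in> topspace (sum_topology X I) \<and> u \<noteq> v"
  obtain i x j y where eq: "u = (i, x)" "v = (j, y)" by (metis surj_pair)
  then have ij: "i \<in> I" "j \<in> I" "x \<in> topspace (X i)" "y \<in> topspace (X j)" using uv by auto
  note op = open_map_component_injection[unfolded open_map_def, rule_format]
  show "\<exists>U V. openin (sum_topology X I) U \<and> openin (sum_topology X I) V \<and> u \<in> U \<and> v \<in> V \<and> disjnt U V"
  proof (cases "i = j")
    case True
    then obtain U V where "openin (X i) U" "openin (X i) V" "x \<in> U" "y \<in> V" "disjnt U V"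
      using assms[OF ij(1)] uv ij eq unfolding Hausdorff_space_def by blast
    then show ?thesis
      using eq True ij op[OF ij(1)]
      by (intro exI[of _ "Pair i ` U"] exI[of _ "Pair i ` V"]) (auto simp: disjnt_iff)
  next
    case False
    then show ?thesis
      using eq ij op[OF ij(1) openin_topspace] op[OF ij(2) openin_topspace]
      by (intro exI[of _ "Pair i ` topspace (X i)"] exI[of _ "Pair j ` topspace (X j)"])
         (auto simp: disjnt_iff)
  qed
qed

lemma continuous_map_sum_topology:
  assumes "\<And>i. i \<in> I \<Longrightarrow> continuous_map (X i) Y (\<lambda>x. f (i, x))"
  shows "continuous_map (sum_topology X I) Y f"
  unfolding continuous_map
proof (intro conjI allI impI)
  show "f ` topspace (sum_topology X I) \<subseteq> topspace Y"
    using assms by (force simp: continuous_map)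
  fix U assume U: "openin Y U"
  have "{x. (i, x) \<in> {u \<in> topspace (sum_topology X I). f u \<in> U}} = {x \<in> topspace (X i). f (i, x) \<in> U}"
    if "i \<in> I" for i using that by auto
  then show "openin (sum_topology X I) {u \<in> topspace (sum_topology X I). f u \<in> U}"
    using openin_continuous_map_preimage[OF assms U] unfolding openin_sum_topology by auto
qed

lemma compact_Hausdorff_fibre_product:
  assumes "compact_space X" "compact_space Y" "Hausdorff_space X" "Hausdorff_space Y" "Hausdorff_space B"
    and f: "continuous_map X B f" and g: "continuous_map Y B g"
  defines "E \<equiv> subtopology (prod_topology X Y) {(x, y). f x = g y}"
  shows "compact_space E" "Hausdorff_space E" "continuous_map E X fst" "continuous_map E Y snd"
    "topspace E = {(x, y). x \<in> topspace X \<and> y \<in> topspace Y \<and> f x = g y}"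
proof -
  let ?P = "prod_topology X Y"
  have "closedin ?P {z \<in> topspace ?P. (f \<circ> fst) z = (g \<circ> snd) z}"
    using assms continuous_map_fst continuous_map_snd
    by (intro closedin_continuous_maps_eq continuous_map_compose) auto
  then have "compactin ?P {z \<in> topspace ?P. (f \<circ> fst) z = (g \<circ> snd) z}"
    using assms by (intro closedin_compact_space) (auto simp: compact_space_prod_topology)
  moreover have "E = subtopology ?P {z \<in> topspace ?P. (f \<circ> fst) z = (g \<circ> snd) z}"
    unfolding E_def subtopology_restrict[of ?P "{(x, y). f x = g y}", symmetric]
    by (intro arg_cong[of _ _ "subtopology ?P"]) auto
  ultimately show "compact_space E" using compact_space_subtopology by auto
  show "Hausdorff_space E"
    unfolding E_def using assms by (intro Hausdorff_space_subtopology) (auto simp: Hausdorff_space_prod_topology)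
qed (auto simp: E_def intro: continuous_map_from_subtopology continuous_map_fst continuous_map_snd)

text \<open>Categories here consist of topologies on a fixed type, so a space built on another type becomes
  an object only after its topology is transported along an injection.\<close>

lemma homeomorphic_copy:
  fixes X :: "'x topology" and \<phi> :: "'x \<Rightarrow> 'y"
  assumes "inj_on \<phi> (topspace X)"
  obtains Y where "homeomorphic_map X Y \<phi>"
proof
  define \<psi> where "\<psi> = inv_into (topspace X) \<phi>"
  let ?Y = "pullback_topology (\<phi> ` topspace X) \<psi> X"
  have top: "topspace ?Y = \<phi> ` topspace X"
    using assms by (auto simp: topspace_pullback_topology \<psi>_def)
  have "homeomorphic_maps X ?Y \<phi> \<psi>"
    unfolding homeomorphic_maps_def
  proof (intro conjI)
    show "continuous_map X ?Y \<phi>"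
    proof (rule continuous_map_pullback')
      show "continuous_map X X (\<psi> \<circ> \<phi>)"
        by (rule continuous_map_eq[OF continuous_map_id]) (auto simp: \<psi>_def assms)
    qed auto
    show "continuous_map ?Y X \<psi>"
      using continuous_map_pullback[OF continuous_map_id] by (metis comp_id id_comp)
  qed (auto simp: top, auto simp: \<psi>_def assms)
  then show "homeomorphic_map X ?Y \<phi>"
    using homeomorphic_map_maps by blast
qed

text \<open>A connected set has connected, hence one-point, images under each of the maps.\<close>

lemma totally_disconnected_jointly_injective:
  assumes Y: "\<And>i. i \<in> I \<Longrightarrow> continuous_map X (Y i) (f i) \<and> totally_disconnected (Y i)"
    and inj: "\<And>x y. x \<in> topspace X \<Longrightarrow> y \<in> topspace X \<Longrightarrow> (\<And>i. i \<in> I \<Longrightarrow> f i x = f i y) \<Longrightarrow> x = y"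
  shows "totally_disconnected X"
  unfolding totally_disconnected_def
proof (intro allI impI)
  fix S assume S: "connectedin X S"
  have "x = y" if "x \<in> S" "y \<in> S" for x y
  proof (rule inj)
    show "x \<in> topspace X" "y \<in> topspace X" using that S connectedin_subset_topspace by auto
    fix i assume "i \<in> I"
    then have "connectedin (Y i) (f i ` S)" "totally_disconnected (Y i)"
      using Y connectedin_continuous_map_image[OF _ S] by auto
    then obtain a where a: "f i ` S \<subseteq> {a}"
      unfolding totally_disconnected_def by meson
    have "f i x \<in> f i ` S" "f i y \<in> f i ` S" using that by auto
    with a show "f i x = f i y" by (metis singletonD subsetD)
  qed
  then show "\<exists>a. S \<subseteq> {a}" by (metis singletonI subsetI)
qed

lemma totally_disconnected_discrete: "totally_disconnected (discrete_topology A)"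
  by (simp add: totally_disconnected_def connectedin_discrete_topology)

lemma totally_disconnected_sum_topology:
  assumes "\<And>i. i \<in> I \<Longrightarrow> totally_disconnected (X i)"
  shows "totally_disconnected (sum_topology X I)"
  unfolding totally_disconnected_def
proof (intro allI impI)
  fix S assume S: "connectedin (sum_topology X I) S"
  have "continuous_map (sum_topology X I) (discrete_topology I) fst"
    by (intro continuous_map_sum_topology) auto
  then obtain i where "fst ` S \<subseteq> {i}"
    using connectedin_continuous_map_image[OF _ S] totally_disconnected_discrete
    unfolding totally_disconnected_def by blast
  show "\<exists>a. S \<subseteq> {a}"
  proof (cases "S = {}")
    case False
    then have S_eq: "S = Pair i ` (snd ` S)" using \<open>fst ` S \<subseteq> {i}\<close> by force
    have Ss: "S \<subseteq> topspace (sum_topology X I)" using S connectedin_subset_topspace by blast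
    then have i: "i \<in> I" using False \<open>fst ` S \<subseteq> {i}\<close> by force
    have "homeomorphic_map (X i) (subtopology (sum_topology X I) (Pair i ` topspace (X i))) (Pair i)"
      using embedding_map_component_injection[OF i] by (simp add: embedding_map_def)
    moreover have "snd ` S \<subseteq> topspace (X i)"
    proof
      fix b assume "b \<in> snd ` S"
      then have "(i, b) \<in> S" using S_eq by blast
      then show "b \<in> topspace (X i)" using Ss by auto
    qed
    moreover have "connectedin (subtopology (sum_topology X I) (Pair i ` topspace (X i))) (Pair i ` snd ` S)"
      unfolding connectedin_subtopology S_eq[symmetric] using S \<open>snd ` S \<subseteq> topspace (X i)\<close> S_eq by blast
    ultimately have "connectedin (X i) (snd ` S)"
      using homeomorphic_map_connectedness_eq by blast
    then obtain a where "snd ` S \<subseteq> {a}" using assms[OF i] unfolding totally_disconnected_def by blast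
    then show ?thesis using S_eq by (intro exI[of _ "(i, a)"]) auto
  qed auto
qed

text \<open>In a compact Hausdorff space components and quasi-components coincide, so clopen sets separate
  points; compactness of \<open>K\<close> makes finitely many of them suffice.\<close>

lemma clopen_separation_totally_disconnected:
  assumes X: "compact_space X" "Hausdorff_space X" "totally_disconnected X"
    and K: "closedin X K" and b: "b \<in> topspace X" "b \<notin> K"
  obtains U where "openin X U" "closedin X U" "b \<in> U" "U \<inter> K = {}"
proof -
  have sep: "\<exists>U. openin X U \<and> closedin X U \<and> x \<in> U \<and> b \<notin> U" if "x \<in> K" for x
  proof (rule ccontr)
    assume no: "\<nexists>U. openin X U \<and> closedin X U \<and> x \<in> U \<and> b \<notin> U"
    have x: "x \<in> topspace X" using that K closedin_subset by blast
    have "quasi_component_of X x b"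
      unfolding quasi_component_of using no x b by auto
    then have "connected_component_of X x b"
      using X quasi_eq_connected_component_of by metis
    then obtain C where "connectedin X C" "x \<in> C" "b \<in> C"
      unfolding connected_component_of_def by blast
    then have "x = b" using X(3) unfolding totally_disconnected_def by blast
    then show False using that b by auto
  qed
  then obtain U where U: "\<And>x. x \<in> K \<Longrightarrow> openin X (U x) \<and> closedin X (U x) \<and> x \<in> U x \<and> b \<notin> U x"
    by metis
  have "compactin X K" using X K closedin_compact_space by blast
  moreover have "K \<subseteq> \<Union>(U ` K)" using U by auto
  ultimately obtain D where D: "finite D" "D \<subseteq> U ` K" "K \<subseteq> \<Union>D"
    using compactinD[of X K "U ` K"] U by blast
  show ?thesis
  proof
    have "openin X (\<Union>D)" "closedin X (\<Union>D)"
      using D U by (auto intro!: openin_Union closedin_Union)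
    then show "openin X (topspace X - \<Union>D)" "closedin X (topspace X - \<Union>D)" by auto
    show "b \<in> topspace X - \<Union>D" using D U b by auto
    show "(topspace X - \<Union>D) \<inter> K = {}" using D by auto
  qed
qed

text \<open>By regularity some neighbourhood of \<open>b\<close> has closure disjoint from \<open>K\<close>, and that closure is open.\<close>

lemma clopen_separation_extremally_disconnected:
  assumes X: "compact_space X" "Hausdorff_space X" "extremally_disconnected X"
    and K: "closedin X K" and b: "b \<in> topspace X" "b \<notin> K"
  obtains U where "openin X U" "closedin X U" "b \<in> U" "U \<inter> K = {}"
proof -
  have "regular_space X" using X compact_Hausdorff_imp_regular_space by blast
  then obtain U where "openin X U" "b \<in> U" "disjnt K (X closure_of U)"
    using K b unfolding regular_space by blast
  with X(3) show ?thesis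
    using that[of "X closure_of U"] closure_of_subset[of U X] openin_subset[of X U]
    by (auto simp: extremally_disconnected_def disjnt_iff)
qed

lemma extremally_disconnected_clopen_subtopology:
  assumes X: "extremally_disconnected X" and W: "openin X W" "closedin X W"
  shows "extremally_disconnected (subtopology X W)"
  unfolding extremally_disconnected_def
proof (intro allI impI)
  fix U assume U: "openin (subtopology X W) U"
  then have UX: "openin X U" "U \<subseteq> W"
    using W by (auto simp: openin_open_subtopology)
  then have "X closure_of U \<subseteq> W" using W by (simp add: closure_of_minimal)
  moreover have "subtopology X W closure_of U = W \<inter> X closure_of U"
    using UX by (simp add: closure_of_subtopology inf.absorb2)
  ultimately show "openin (subtopology X W) (subtopology X W closure_of U)"
    using X UX W by (auto simp: extremally_disconnected_def openin_open_subtopology)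
qed

section \<open>Sheaves on a category\<close>

lemma effective_epi_familyD:
  assumes epi: "effective_epi_family C I f B" and W: "W \<in> Obj C"
    and e: "\<And>i. i \<in> I \<Longrightarrow> e i \<in> hom_set C (Dom C (f i)) W"
    and compat: "\<And>i j Z g h. \<lbrakk>i \<in> I; j \<in> I; Z \<in> Obj C; g \<in> hom_set C Z (Dom C (f i));
        h \<in> hom_set C Z (Dom C (f j)); Cmp C (f i) g = Cmp C (f j) h\<rbrakk> \<Longrightarrow> Cmp C (e i) g = Cmp C (e j) h"
  shows "\<exists>!d. d \<in> hom_set C B W \<and> (\<forall>i\<in>I. Cmp C d (f i) = e i)"
proof -
  have "\<forall>W\<in>Obj C. \<forall>e.
        (\<forall>i\<in>I. e i \<in> hom_set C (Dom C (f i)) W) \<and>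
        (\<forall>i\<in>I. \<forall>j\<in>I. \<forall>Z\<in>Obj C.
           \<forall>g\<in>hom_set C Z (Dom C (f i)). \<forall>h\<in>hom_set C Z (Dom C (f j)).
             Cmp C (f i) g = Cmp C (f j) h \<longrightarrow> Cmp C (e i) g = Cmp C (e j) h)
        \<longrightarrow> (\<exists>!d. d \<in> hom_set C B W \<and> (\<forall>i\<in>I. Cmp C d (f i) = e i))"
    using epi unfolding effective_epi_family_def by (elim conjE)
  from this[THEN bspec, OF W, THEN spec, of e] show ?thesis
  proof (rule mp, intro conjI ballI impI)
    show "e i \<in> hom_set C (Dom C (f i)) W" if "i \<in> I" for i using that by (rule e)
    fix i j Z g h
    assume "i \<in> I" "j \<in> I" "Z \<in> Obj C" "g \<in> hom_set C Z (Dom C (f i))"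
      "h \<in> hom_set C Z (Dom C (f j))" "Cmp C (f i) g = Cmp C (f j) h"
    then show "Cmp C (e i) g = Cmp C (e j) h" by (rule compat)
  qed
qed

locale category =
  fixes C :: "('o, 'm) category_data"
  assumes is_category: "is_category C"
begin

lemma Dom_in_Obj: "f \<in> Arr C \<Longrightarrow> Dom C f \<in> Obj C"
  using is_category by (auto simp: is_category_def)

lemma Cmp_in_Arr:
  assumes "f \<in> Arr C" "g \<in> Arr C" "Dom C g = Cod C f"
  shows "Cmp C g f \<in> Arr C" "Dom C (Cmp C g f) = Dom C f" "Cod C (Cmp C g f) = Cod C g"
  using is_category assms by (auto simp: is_category_def hom_set_def)

lemma Cmp_assoc:
  assumes "f \<in> Arr C" "g \<in> Arr C" "h \<in> Arr C" "Dom C g = Cod C f" "Dom C h = Cod C g"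
  shows "Cmp C h (Cmp C g f) = Cmp C (Cmp C h g) f"
  using is_category assms by (simp add: is_category_def)

lemma Ident_Arr:
  assumes "B \<in> Obj C"
  shows "Ident C B \<in> Arr C" "Dom C (Ident C B) = B" "Cod C (Ident C B) = B"
  using is_category assms by (auto simp: is_category_def hom_set_def)

lemma Ident_Cmp: "f \<in> Arr C \<Longrightarrow> Cmp C (Ident C (Cod C f)) f = f"
  using is_category by (simp add: is_category_def)

lemma Cmp_Ident: "f \<in> Arr C \<Longrightarrow> Cmp C f (Ident C (Dom C f)) = f"
  using is_category by (simp add: is_category_def)

lemma is_sieve_pullback:
  assumes S: "is_sieve C (Cod C f) S" and f: "f \<in> Arr C"
  shows "is_sieve C (Dom C f) (pullback_sieve C f S)"
  unfolding is_sieve_def pullback_sieve_def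
proof (intro conjI ballI impI subsetI)
  fix h k
  assume h: "h \<in> {g \<in> Arr C. Cod C g = Dom C f \<and> Cmp C f g \<in> S}"
    and k: "k \<in> Arr C" "Cod C k = Dom C h"
  then have "Cmp C (Cmp C f h) k \<in> S"
    using S f by (simp add: is_sieve_def Cmp_in_Arr)
  with h k f show "Cmp C h k \<in> {g \<in> Arr C. Cod C g = Dom C f \<and> Cmp C f g \<in> S}"
    by (simp add: Cmp_in_Arr Cmp_assoc)
qed auto

lemma is_sieve_generated:
  assumes f: "\<And>i. i \<in> I \<Longrightarrow> f i \<in> Arr C \<and> Cod C (f i) = B"
  shows "is_sieve C B (generated_sieve C I f)"
  unfolding is_sieve_def
proof (intro conjI ballI impI)
  show "generated_sieve C I f \<subseteq> {f \<in> Arr C. Cod C f = B}"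
    using f by (auto simp: generated_sieve_def Cmp_in_Arr)
next
  fix h k
  assume "h \<in> generated_sieve C I f" and k: "k \<in> Arr C" "Cod C k = Dom C h"
  then obtain i g where h: "h = Cmp C (f i) g" "i \<in> I" "g \<in> Arr C" "Cod C g = Dom C (f i)"
    by (auto simp: generated_sieve_def)
  have "Cmp C h k = Cmp C (f i) (Cmp C g k)"
    using f h k by (simp add: Cmp_assoc Cmp_in_Arr)
  moreover have "Cmp C g k \<in> Arr C" "Cod C (Cmp C g k) = Dom C (f i)"
    using f h k by (auto simp: Cmp_in_Arr)
  ultimately show "Cmp C h k \<in> generated_sieve C I f"
    using h by (auto simp: generated_sieve_def)
qed

lemma coproduct_effective_epi_family:
  "is_coproduct C I T P \<iota> \<Longrightarrow> effective_epi_family C I \<iota> P"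
  unfolding is_coproduct_def effective_epi_family_def by (auto simp: hom_set_def)

end

locale presheaf = category C for C :: "('o, 'm) category_data" +
  fixes X :: "('o, 'm, 'b) presheaf_data"
  assumes is_presheaf: "is_presheaf C X"
begin

lemma Res_in_Sec: "f \<in> Arr C \<Longrightarrow> x \<in> Sec X (Cod C f) \<Longrightarrow> Res X f x \<in> Sec X (Dom C f)"
  using is_presheaf by (auto simp: is_presheaf_def)

lemma Res_Ident: "A \<in> Obj C \<Longrightarrow> x \<in> Sec X A \<Longrightarrow> Res X (Ident C A) x = x"
  using is_presheaf by (simp add: is_presheaf_def)

lemma Res_Cmp:
  assumes "f \<in> Arr C" "g \<in> Arr C" "Dom C g = Cod C f" "x \<in> Sec X (Cod C g)"
  shows "Res X (Cmp C g f) x = Res X f (Res X g x)"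
  using is_presheaf assms by (simp add: is_presheaf_def)

text \<open>The sheaf condition for a generated sieve, in terms of the generators only: a compatible family
  on the generators extends to the sieve by \<open>x (f\<^sub>i g) = Res g (y\<^sub>i)\<close>, and compatibility says
  that this does not depend on how an arrow is factored.\<close>

lemma sheaf_amalgamation:
  assumes sheaf: "is_sheaf C J X" and B: "B \<in> Obj C" and cover: "generated_sieve C I f \<in> J B"
    and f: "\<And>i. i \<in> I \<Longrightarrow> f i \<in> Arr C \<and> Cod C (f i) = B"
    and y: "\<And>i. i \<in> I \<Longrightarrow> y i \<in> Sec X (Dom C (f i))"
    and compat: "\<And>i j g h. \<lbrakk>i \<in> I; j \<in> I; g \<in> Arr C; h \<in> Arr C; Dom C g = Dom C h;
        Cod C g = Dom C (f i); Cod C h = Dom C (f j); Cmp C (f i) g = Cmp C (f j) h\<rbrakk>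
        \<Longrightarrow> Res X g (y i) = Res X h (y j)"
  shows "\<exists>!s. s \<in> Sec X B \<and> (\<forall>i\<in>I. Res X (f i) s = y i)"
proof -
  let ?S = "generated_sieve C I f"
  define x where "x k = (SOME v. \<exists>i\<in>I. \<exists>g\<in>Arr C. Cod C g = Dom C (f i) \<and> k = Cmp C (f i) g
    \<and> v = Res X g (y i))" for k
  have x: "x (Cmp C (f i) g) = Res X g (y i)"
    if "i \<in> I" "g \<in> Arr C" "Cod C g = Dom C (f i)" for i g
  proof -
    let ?Q = "\<lambda>v. \<exists>j\<in>I. \<exists>h\<in>Arr C. Cod C h = Dom C (f j) \<and> Cmp C (f i) g = Cmp C (f j) h
      \<and> v = Res X h (y j)"
    have "?Q (Res X g (y i))" using that by blast
    then have "?Q (x (Cmp C (f i) g))" unfolding x_def by (rule someI)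
    then obtain j h where jh: "j \<in> I" "h \<in> Arr C" "Cod C h = Dom C (f j)"
      "Cmp C (f i) g = Cmp C (f j) h" "x (Cmp C (f i) g) = Res X h (y j)" by blast
    have "Dom C g = Dom C (Cmp C (f i) g)"
      using f[OF that(1)] that by (simp add: Cmp_in_Arr)
    also have "\<dots> = Dom C h"
      unfolding jh(4) using f[OF jh(1)] jh(2,3) by (simp add: Cmp_in_Arr)
    finally have "Res X g (y i) = Res X h (y j)"
      by (rule compat[OF that(1) jh(1) that(2) jh(2) _ that(3) jh(3,4)])
    then show ?thesis using jh(5) by simp
  qed
  have unique: "\<exists>!s. s \<in> Sec X B \<and> (\<forall>k\<in>?S. Res X k s = x k)"
  proof -
    have "x k \<in> Sec X (Dom C k)" if "k \<in> ?S" for k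
      using that f y by (auto simp: generated_sieve_def x Cmp_in_Arr intro!: Res_in_Sec)
    moreover have "Res X g (x k) = x (Cmp C k g)"
      if k: "k \<in> ?S" and g: "g \<in> Arr C" "Cod C g = Dom C k" for k g
    proof -
      from k obtain i l where il: "k = Cmp C (f i) l" "i \<in> I" "l \<in> Arr C" "Cod C l = Dom C (f i)"
        by (auto simp: generated_sieve_def)
      have gl: "Cod C g = Dom C l" using g il f by (simp add: Cmp_in_Arr)
      have "x (Cmp C k g) = x (Cmp C (f i) (Cmp C l g))"
        using il f g gl by (simp add: Cmp_assoc)
      also have "\<dots> = Res X (Cmp C l g) (y i)"
        using il g gl by (intro x) (auto simp: Cmp_in_Arr)
      also have "\<dots> = Res X g (Res X l (y i))"
        using il g gl y by (intro Res_Cmp) auto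
      finally show ?thesis using il x by simp
    qed
    ultimately show ?thesis
      using sheaf B cover unfolding is_sheaf_def by simp
  qed
  have "(\<forall>k\<in>?S. Res X k s = x k) \<longleftrightarrow> (\<forall>i\<in>I. Res X (f i) s = y i)" if s: "s \<in> Sec X B" for s
  proof
    assume gen: "\<forall>k\<in>?S. Res X k s = x k"
    show "\<forall>i\<in>I. Res X (f i) s = y i"
    proof
      fix i assume i: "i \<in> I"
      let ?id = "Ident C (Dom C (f i))"
      have id: "?id \<in> Arr C" "Cod C ?id = Dom C (f i)"
        using f[OF i] Dom_in_Obj Ident_Arr by auto
      then have "Cmp C (f i) ?id \<in> ?S" using i by (auto simp: generated_sieve_def)
      then have "Res X (Cmp C (f i) ?id) s = Res X ?id (y i)"
        using gen x[OF i id] by simp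
      then show "Res X (f i) s = y i"
        using f[OF i] y[OF i] by (simp add: Cmp_Ident Res_Ident Dom_in_Obj)
    qed
  next
    assume "\<forall>i\<in>I. Res X (f i) s = y i"
    then show "\<forall>k\<in>?S. Res X k s = x k"
      using f s by (auto simp: generated_sieve_def x Res_Cmp)
  qed
  then show ?thesis using unique by metis
qed

lemma coherent_sheaf_amalgamation:
  fixes I :: "nat set"
  assumes sheaf: "is_sheaf C (coherent_topology C) X"
    and I: "finite I" "effective_epi_family C I f B"
    and y: "\<And>i. i \<in> I \<Longrightarrow> y i \<in> Sec X (Dom C (f i))"
    and compat: "\<And>i j g h. \<lbrakk>i \<in> I; j \<in> I; g \<in> Arr C; h \<in> Arr C; Dom C g = Dom C h;
        Cod C g = Dom C (f i); Cod C h = Dom C (f j); Cmp C (f i) g = Cmp C (f j) h\<rbrakk>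
        \<Longrightarrow> Res X g (y i) = Res X h (y j)"
  shows "\<exists>!s. s \<in> Sec X B \<and> (\<forall>i\<in>I. Res X (f i) s = y i)"
proof (rule sheaf_amalgamation[OF sheaf])
  show "generated_sieve C I f \<in> coherent_topology C B"
    using coherent_topology_least(1)[unfolded contains_finite_effective_epis_def, rule_format, OF conjI[OF I]] .
  show "B \<in> Obj C" and "\<And>i. i \<in> I \<Longrightarrow> f i \<in> Arr C \<and> Cod C (f i) = B"
    using I(2) unfolding effective_epi_family_def by simp_all
qed (fact y, fact compat)

text \<open>The inclusions of a coproduct form an effective epimorphic family, so sections of a sheaf over it
  are the compatible families on the summands. Arrows equalized by two inclusions are either equal,
  or start at an object covered by the empty family, over which there is only one section. Hence
  all families are compatible.\<close>

lemma coherent_sheaf_bij_betw_coproduct: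
  fixes I :: "nat set"
  assumes sheaf: "is_sheaf C (coherent_topology C) X"
    and I: "finite I" and coprod: "is_coproduct C I T P \<iota>"
    and disjoint: "\<And>i j g h. \<lbrakk>i \<in> I; j \<in> I; g \<in> Arr C; h \<in> Arr C; Dom C g = Dom C h;
        Cod C g = T i; Cod C h = T j; Cmp C (\<iota> i) g = Cmp C (\<iota> j) h\<rbrakk>
        \<Longrightarrow> i = j \<and> g = h \<or> effective_epi_family C ({}::nat set) \<iota> (Dom C g)"
  shows "bij_betw (\<lambda>x. \<lambda>i\<in>I. Res X (\<iota> i) x) (Sec X P) (\<Pi>\<^sub>E i\<in>I. Sec X (T i))"
proof -
  have \<iota>: "\<iota> i \<in> Arr C" "Dom C (\<iota> i) = T i" "Cod C (\<iota> i) = P" if "i \<in> I" for i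
    using coprod that by (auto simp: is_coproduct_def hom_set_def)
  have glue: "\<exists>!s. s \<in> Sec X P \<and> (\<forall>i\<in>I. Res X (\<iota> i) s = y i)"
    if y: "\<And>i. i \<in> I \<Longrightarrow> y i \<in> Sec X (T i)" for y
  proof (rule coherent_sheaf_amalgamation[OF sheaf I coproduct_effective_epi_family[OF coprod]])
    fix i j g h
    assume ij: "i \<in> I" "j \<in> I" and gh: "g \<in> Arr C" "h \<in> Arr C" "Dom C g = Dom C h"
      "Cod C g = Dom C (\<iota> i)" "Cod C h = Dom C (\<iota> j)" "Cmp C (\<iota> i) g = Cmp C (\<iota> j) h"
    consider "i = j \<and> g = h" | "effective_epi_family C ({}::nat set) \<iota> (Dom C g)"
      using disjoint[of i j g h] ij gh \<iota> by auto
    then show "Res X g (y i) = Res X h (y j)"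
    proof cases
      case 2
      have "\<exists>!s. s \<in> Sec X (Dom C g) \<and> (\<forall>i\<in>{}::nat set. Res X (\<iota> i) s = undefined)"
        by (rule coherent_sheaf_amalgamation[OF sheaf _ 2]) auto
      moreover have "Res X g (y i) \<in> Sec X (Dom C g)" "Res X h (y j) \<in> Sec X (Dom C g)"
        using Res_in_Sec[of g] Res_in_Sec[of h] gh ij \<iota> y by auto
      ultimately show ?thesis by auto
    qed auto
  qed (use y \<iota> in auto)
  show ?thesis
    unfolding bij_betw_def
  proof (intro conjI subset_antisym)
    show "inj_on (\<lambda>x. \<lambda>i\<in>I. Res X (\<iota> i) x) (Sec X P)"
    proof (rule inj_onI)
      fix s t assume st: "s \<in> Sec X P" "t \<in> Sec X P"
        "(\<lambda>i\<in>I. Res X (\<iota> i) s) = (\<lambda>i\<in>I. Res X (\<iota> i) t)"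
      then have "\<forall>i\<in>I. Res X (\<iota> i) s = Res X (\<iota> i) t" by (metis restrict_apply')
      moreover have "Res X (\<iota> i) s \<in> Sec X (T i)" if "i \<in> I" for i
        using Res_in_Sec[of "\<iota> i" s] \<iota>[OF that] st by simp
      ultimately show "s = t"
        using glue[of "\<lambda>i. Res X (\<iota> i) s"] st by metis
    qed
    show "(\<lambda>x. \<lambda>i\<in>I. Res X (\<iota> i) x) ` Sec X P \<subseteq> (\<Pi>\<^sub>E i\<in>I. Sec X (T i))"
      using \<iota> Res_in_Sec by fastforce
    show "(\<Pi>\<^sub>E i\<in>I. Sec X (T i)) \<subseteq> (\<lambda>x. \<lambda>i\<in>I. Res X (\<iota> i) x) ` Sec X P"
    proof
      fix y assume y: "y \<in> (\<Pi>\<^sub>E i\<in>I. Sec X (T i))"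
      then obtain s where s: "s \<in> Sec X P" "\<forall>i\<in>I. Res X (\<iota> i) s = y i"
        using glue[of y] by auto
      then have "(\<lambda>i\<in>I. Res X (\<iota> i) s) = y"
        using y by (auto simp: fun_eq_iff PiE_def extensional_def)
      then show "y \<in> (\<lambda>x. \<lambda>i\<in>I. Res X (\<iota> i) x) ` Sec X P" using s by blast
    qed
  qed
qed

text \<open>Two arrows that \<open>\<pi>\<close> equalizes factor jointly through the pullback. So a section over the source of \<open>\<pi>\<close>
  is compatible as soon as its restrictions along the two projections agree.\<close>

lemma coherent_sheaf_equalizer:
  assumes sheaf: "is_sheaf C (coherent_topology C) X"
    and \<pi>: "\<pi> \<in> Arr C" and epi: "effective_epi_family C {0::nat} (\<lambda>_. \<pi>) (Cod C \<pi>)"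
    and pb: "is_pullback C \<pi> \<pi> P p q"
  shows "is_set_equalizer (Sec X (Cod C \<pi>)) (Res X \<pi>) (Sec X (Dom C \<pi>)) (Res X p) (Res X q)"
proof -
  have pq: "p \<in> Arr C" "q \<in> Arr C" "Dom C p = P" "Dom C q = P" "Cod C p = Dom C \<pi>"
    "Cod C q = Dom C \<pi>" "Cmp C \<pi> p = Cmp C \<pi> q"
    using pb by (auto simp: is_pullback_def hom_set_def)
  have glue: "\<exists>!s. s \<in> Sec X (Cod C \<pi>) \<and> Res X \<pi> s = y"
    if y: "y \<in> Sec X (Dom C \<pi>)" "Res X p y = Res X q y" for y
  proof -
    have "\<exists>!s. s \<in> Sec X (Cod C \<pi>) \<and> (\<forall>i\<in>{0::nat}. Res X \<pi> s = y)"
    proof (rule coherent_sheaf_amalgamation[OF sheaf _ epi])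
      fix g h
      assume gh: "g \<in> Arr C" "h \<in> Arr C" "Dom C g = Dom C h"
        "Cod C g = Dom C \<pi>" "Cod C h = Dom C \<pi>" "Cmp C \<pi> g = Cmp C \<pi> h"
      then have "g \<in> hom_set C (Dom C g) (Dom C \<pi>)" "h \<in> hom_set C (Dom C g) (Dom C \<pi>)"
        by (auto simp: hom_set_def)
      then obtain d where "d \<in> hom_set C (Dom C g) P" "Cmp C p d = g" "Cmp C q d = h"
        using pb gh Dom_in_Obj[OF gh(1)] unfolding is_pullback_def by metis
      then have d: "d \<in> Arr C" "Cod C d = P" "Cmp C p d = g" "Cmp C q d = h"
        by (auto simp: hom_set_def)
      have "Res X g y = Res X d (Res X p y)"
        using Res_Cmp[of d p y] d pq y by simp
      also have "\<dots> = Res X h y"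
        using Res_Cmp[of d q y] d pq y by simp
      finally show "Res X g y = Res X h y" .
    qed (use y in auto)
    then show ?thesis by simp
  qed
  have eq: "Res X p (Res X \<pi> s) = Res X q (Res X \<pi> s)" if "s \<in> Sec X (Cod C \<pi>)" for s
    using Res_Cmp[of p \<pi> s] Res_Cmp[of q \<pi> s] \<pi> pq that by simp
  show ?thesis
    unfolding is_set_equalizer_def bij_betw_def
  proof (intro conjI subset_antisym)
    show "inj_on (Res X \<pi>) (Sec X (Cod C \<pi>))"
    proof (rule inj_onI)
      fix s t assume st: "s \<in> Sec X (Cod C \<pi>)" "t \<in> Sec X (Cod C \<pi>)" "Res X \<pi> s = Res X \<pi> t"
      then show "s = t" using glue[of "Res X \<pi> s"] eq Res_in_Sec[OF \<pi>] by metis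
    qed
    show "Res X \<pi> ` Sec X (Cod C \<pi>) \<subseteq> {x \<in> Sec X (Dom C \<pi>). Res X p x = Res X q x}"
      using eq Res_in_Sec[OF \<pi>] by auto
    show "{x \<in> Sec X (Dom C \<pi>). Res X p x = Res X q x} \<subseteq> Res X \<pi> ` Sec X (Cod C \<pi>)"
      using glue by blast
  qed
qed

end

section \<open>Full categories of compact Hausdorff spaces\<close>

definition mk_map :: "'a topology \<Rightarrow> 'a topology \<Rightarrow> ('a \<Rightarrow> 'a) \<Rightarrow> 'a tmap" where
  "mk_map S T f = TMap S T (restrict f (topspace S))"

lemma mk_map_simps [simp]:
  "tdom (mk_map S T f) = S" "tcod (mk_map S T f) = T"
  "x \<in> topspace S \<Longrightarrow> tfun (mk_map S T f) x = f x"
  by (simp_all add: mk_map_def)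

definition covers :: "'a tmap set \<Rightarrow> 'a topology \<Rightarrow> bool" where
  "covers F B \<longleftrightarrow> finite F \<and> (\<forall>f\<in>F. tcod f = B) \<and> topspace B \<subseteq> (\<Union>f\<in>F. tfun f ` topspace (tdom f))"

locale full_category = category "full_Top K" for K :: "'a topology set"
begin

abbreviation C where "C \<equiv> full_Top K"

lemma C_simps [simp]: "Obj C = K" "Dom C = tdom" "Cod C = tcod"
  by (simp_all add: full_Top_def)

lemma Arr_iff:
  "f \<in> Arr C \<longleftrightarrow> tdom f \<in> K \<and> tcod f \<in> K \<and> continuous_map (tdom f) (tcod f) (tfun f) \<and>
     tfun f \<in> extensional (topspace (tdom f))"
  by (simp add: full_Top_def)

lemma tfun_in_topspace: "f \<in> Arr C \<Longrightarrow> x \<in> topspace (tdom f) \<Longrightarrow> tfun f x \<in> topspace (tcod f)"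
  unfolding Arr_iff by (meson continuous_map_image_subset_topspace image_subset_iff)

lemma Cmp_simps [simp]:
  "tdom (Cmp C g f) = tdom f" "tcod (Cmp C g f) = tcod g"
  "x \<in> topspace (tdom f) \<Longrightarrow> tfun (Cmp C g f) x = tfun g (tfun f x)"
  by (simp_all add: full_Top_def compose_def)

lemma Arr_eqI:
  assumes "f \<in> Arr C" "g \<in> Arr C" "tdom f = tdom g" "tcod f = tcod g"
    and "\<And>x. x \<in> topspace (tdom f) \<Longrightarrow> tfun f x = tfun g x"
  shows "f = g"
proof -
  have "tfun f = tfun g"
    using assms by (intro extensionalityI[of _ "topspace (tdom f)"]) (auto simp: Arr_iff)
  then show ?thesis using assms by (cases f; cases g) simp
qed

lemma mk_map_Arr: "S \<in> K \<Longrightarrow> T \<in> K \<Longrightarrow> continuous_map S T f \<Longrightarrow> mk_map S T f \<in> Arr C"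
  by (auto simp: Arr_iff mk_map_def elim: continuous_map_eq)

lemma mk_map_hom: "S \<in> K \<Longrightarrow> T \<in> K \<Longrightarrow> continuous_map S T f \<Longrightarrow> mk_map S T f \<in> hom_set C S T"
  by (simp add: hom_set_def mk_map_Arr)

lemma Cmp_Arr: "f \<in> Arr C \<Longrightarrow> g \<in> Arr C \<Longrightarrow> tdom g = tcod f \<Longrightarrow> Cmp C g f \<in> Arr C"
  using Cmp_in_Arr(1)[of f g] by simp

lemma constant_hom: "S \<in> K \<Longrightarrow> T \<in> K \<Longrightarrow> a \<in> topspace T \<Longrightarrow> mk_map S T (\<lambda>_. a) \<in> hom_set C S T"
  by (rule mk_map_hom) auto

end

lemma full_category: "full_category K"
  by unfold_locales (rule is_category_full_Top)

text \<open>The properties that the three categories share and that the identification of the coherent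
  topology rests on. The last two are the ones whose proofs differ: \<open>separation\<close> shows
  that a family with a map missing from its joint image is not effective epimorphic, and
  \<open>refinement\<close> replaces pulling back a family, since fibre products of Stonean spaces
  need not be Stonean.\<close>

locale compact_Hausdorff_category = full_category K for K :: "'a topology set" +
  assumes compact: "T \<in> K \<Longrightarrow> compact_space T"
    and Hausdorff: "T \<in> K \<Longrightarrow> Hausdorff_space T"
    and discrete: "finite A \<Longrightarrow> discrete_topology A \<in> K"
    and two_points: "\<exists>a b :: 'a. a \<noteq> b"
    and separation: "\<lbrakk>B \<in> K; closedin B A; b \<in> topspace B; b \<notin> A\<rbrakk> \<Longrightarrow>
      \<exists>W\<in>K. \<exists>u v. continuous_map B W u \<and> continuous_map B W v \<and> (\<forall>a\<in>A. u a = v a) \<and> u b \<noteq> v b"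
    and refinement: "\<lbrakk>B \<in> K; covers F B; F \<subseteq> Arr C; g \<in> Arr C; tcod g = B\<rbrakk> \<Longrightarrow>
      \<exists>F'. covers F' (tdom g) \<and> F' \<subseteq> Arr C \<and>
        (\<forall>f'\<in>F'. \<exists>f\<in>F. \<exists>h\<in>Arr C. tcod h = tdom f \<and>
           Cmp C g f' = Cmp C f h)"
begin

abbreviation point :: "'a topology" where "point \<equiv> discrete_topology {undefined}"

lemma point_K: "point \<in> K" by (rule discrete) simp

abbreviation point_map :: "'a topology \<Rightarrow> 'a \<Rightarrow> 'a tmap" where
  "point_map T x \<equiv> mk_map point T (\<lambda>_. x)"

text \<open>From left to right: a point \<open>b\<close> outside the closed joint image would admit two maps \<open>u\<close> and \<open>v\<close>
  which agree on the image and differ at \<open>b\<close>, contradicting uniqueness. From right to left: testing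
  compatibility on the one-point space shows that the values \<open>e\<^sub>i(x)\<close> depend only on \<open>f\<^sub>i(x)\<close>. The
  resulting function on \<open>B\<close> is continuous since preimages of closed sets are finite unions of
  images of closed sets under closed maps.\<close>

lemma effective_epi_family_iff:
  assumes "finite I"
  shows "effective_epi_family C I f B \<longleftrightarrow>
    B \<in> K \<and> (\<forall>i\<in>I. f i \<in> Arr C \<and> tcod (f i) = B) \<and>
    topspace B \<subseteq> (\<Union>i\<in>I. tfun (f i) ` topspace (tdom (f i)))" (is "?L \<longleftrightarrow> ?R")
proof
  assume L: ?L
  then have B: "B \<in> K" and f: "\<And>i. i \<in> I \<Longrightarrow> f i \<in> Arr C \<and> tcod (f i) = B"
    by (auto simp: effective_epi_family_def)
  let ?A = "\<Union>i\<in>I. tfun (f i) ` topspace (tdom (f i))"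
  have "topspace B \<subseteq> ?A"
  proof
    fix b assume b: "b \<in> topspace B"
    show "b \<in> ?A"
    proof (rule ccontr)
      assume nb: "b \<notin> ?A"
      have "closedin B (tfun (f i) ` topspace (tdom (f i)))" if "i \<in> I" for i
      proof -
        have "closed_map (tdom (f i)) B (tfun (f i))"
          using f[OF that] by (intro continuous_imp_closed_map) (auto simp: Arr_iff compact Hausdorff)
        then show ?thesis by (simp add: closed_map_def)
      qed
      then have "closedin B ?A" using assms by (auto intro: closedin_Union)
      then obtain W u v where W: "W \<in> K" and u: "continuous_map B W u" and v: "continuous_map B W v"
        and uv: "\<And>a. a \<in> ?A \<Longrightarrow> u a = v a" and ub: "u b \<noteq> v b"
        using separation[OF B _ b nb] by blast
      let ?u = "mk_map B W u" and ?v = "mk_map B W v"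
      have uA: "?u \<in> hom_set C B W" "?v \<in> hom_set C B W" using B W u v by (auto intro: mk_map_hom)
      let ?e = "\<lambda>i. Cmp C ?u (f i)"
      have e: "?e i \<in> hom_set C (Dom C (f i)) W" if "i \<in> I" for i
        using uA f[OF that] by (auto simp: hom_set_def intro: Cmp_Arr)
      have ev: "Cmp C ?v (f i) = ?e i" if i: "i \<in> I" for i
      proof (rule Arr_eqI)
        fix x assume "x \<in> topspace (tdom (Cmp C ?v (f i)))"
        then have x: "x \<in> topspace (tdom (f i))" by simp
        then have "tfun (f i) x \<in> topspace B" using f[OF i] tfun_in_topspace by metis
        moreover have "tfun (f i) x \<in> ?A" using i x by blast
        ultimately show "tfun (Cmp C ?v (f i)) x = tfun (?e i) x" using x uv by simp
      qed (use uA f[OF i] in \<open>auto simp: hom_set_def intro: Cmp_Arr\<close>)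
      have compat: "Cmp C (?e i) g = Cmp C (?e j) h"
        if "i \<in> I" "j \<in> I" "g \<in> hom_set C Z (Dom C (f i))" "h \<in> hom_set C Z (Dom C (f j))"
          "Cmp C (f i) g = Cmp C (f j) h" for i j Z g h
      proof -
        have "Cmp C (?e i) g = Cmp C ?u (Cmp C (f i) g)"
          using that uA f[OF that(1)] by (intro Cmp_assoc[symmetric]) (auto simp: hom_set_def)
        also have "\<dots> = Cmp C (?e j) h"
          unfolding that(5) using that uA f[OF that(2)] by (intro Cmp_assoc) (auto simp: hom_set_def)
        finally show ?thesis .
      qed
      have "\<exists>!d. d \<in> hom_set C B W \<and> (\<forall>i\<in>I. Cmp C d (f i) = ?e i)"
      proof (rule effective_epi_familyD[OF L])
        show "W \<in> Obj C" using W by simp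
      qed (erule e, erule (4) compat)
      then have "?u = ?v" using uA ev by blast
      then have "tfun ?u b = tfun ?v b" by simp
      then show False using ub b by simp
    qed
  qed
  with B f show ?R by blast
next
  assume R: ?R
  then have f: "\<And>i. i \<in> I \<Longrightarrow> f i \<in> Arr C \<and> tcod (f i) = B" by blast
  show ?L
    unfolding effective_epi_family_def
  proof (intro conjI ballI allI impI)
    fix W e assume W: "W \<in> Obj C"
    assume as: "(\<forall>i\<in>I. e i \<in> hom_set C (Dom C (f i)) W) \<and>
        (\<forall>i\<in>I. \<forall>j\<in>I. \<forall>Z\<in>Obj C.
           \<forall>g\<in>hom_set C Z (Dom C (f i)). \<forall>h\<in>hom_set C Z (Dom C (f j)).
             Cmp C (f i) g = Cmp C (f j) h \<longrightarrow> Cmp C (e i) g = Cmp C (e j) h)"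
    then have e: "e i \<in> Arr C" "tdom (e i) = tdom (f i)" "tcod (e i) = W" if "i \<in> I" for i
      using that by (auto simp: hom_set_def)
    have compat: "tfun (e i) x = tfun (e j) y"
      if ij: "i \<in> I" "j \<in> I" and x: "x \<in> topspace (tdom (f i))" and y: "y \<in> topspace (tdom (f j))"
        and eq: "tfun (f i) x = tfun (f j) y" for i j x y
    proof -
      let ?g = "point_map (tdom (f i)) x" and ?h = "point_map (tdom (f j)) y"
      have g: "?g \<in> hom_set C point (Dom C (f i))" "?h \<in> hom_set C point (Dom C (f j))"
        using f[OF ij(1)] f[OF ij(2)] x y point_K by (auto intro!: constant_hom simp: Arr_iff)
      have "Cmp C (f i) ?g = Cmp C (f j) ?h"
        by (rule Arr_eqI) (use g f[OF ij(1)] f[OF ij(2)] eq in \<open>auto simp: hom_set_def intro!: Cmp_Arr\<close>)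
      moreover have "point \<in> Obj C" using point_K by simp
      ultimately have "Cmp C (e i) ?g = Cmp C (e j) ?h"
        using bspec[OF bspec[OF bspec[OF bspec[OF bspec[OF conjunct2[OF as] ij(1)] ij(2)]] g(1)] g(2)] by metis
      then have "tfun (Cmp C (e i) ?g) undefined = tfun (Cmp C (e j) ?h) undefined" by simp
      then show ?thesis by simp
    qed
    have "\<exists>w. \<forall>i\<in>I. \<forall>x\<in>topspace (tdom (f i)). tfun (f i) x = b \<longrightarrow> w = tfun (e i) x" for b
    proof (cases "\<exists>i\<in>I. \<exists>x\<in>topspace (tdom (f i)). tfun (f i) x = b")
      case True
      then obtain i x where "i \<in> I" "x \<in> topspace (tdom (f i))" "tfun (f i) x = b" by blast
      then show ?thesis using compat[of _ i _ x] by (intro exI[of _ "tfun (e i) x"]) metis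
    qed blast
    then obtain w where "\<forall>b. \<forall>i\<in>I. \<forall>x\<in>topspace (tdom (f i)). tfun (f i) x = b \<longrightarrow> w b = tfun (e i) x"
      by metis
    then have w: "w (tfun (f i) x) = tfun (e i) x" if "i \<in> I" "x \<in> topspace (tdom (f i))" for i x
      using that by blast
    have surj: "\<exists>i\<in>I. \<exists>x\<in>topspace (tdom (f i)). b = tfun (f i) x" if "b \<in> topspace B" for b
      using R that by blast
    have "continuous_map B W w"
      unfolding continuous_map_closedin
    proof (intro conjI allI impI Pi_I)
      fix b assume "b \<in> topspace B"
      then obtain i x where ix: "i \<in> I" "x \<in> topspace (tdom (f i))" "b = tfun (f i) x" using surj by blast
      then show "w b \<in> topspace W" using w e[OF ix(1)] tfun_in_topspace[of "e i" x] by simp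
    next
      fix D assume D: "closedin W D"
      let ?D = "\<lambda>i. {x \<in> topspace (tdom (f i)). tfun (e i) x \<in> D}"
      have cl: "closedin B (tfun (f i) ` ?D i)" if "i \<in> I" for i
      proof -
        have "closed_map (tdom (f i)) B (tfun (f i))"
          using f[OF that] by (intro continuous_imp_closed_map) (auto simp: Arr_iff compact Hausdorff)
        moreover have "closedin (tdom (f i)) (?D i)"
          using e[OF that] D by (intro closedin_continuous_map_preimage[of _ W]) (auto simp: Arr_iff)
        ultimately show ?thesis by (simp add: closed_map_def)
      qed
      have "{b \<in> topspace B. w b \<in> D} = (\<Union>i\<in>I. tfun (f i) ` ?D i)"
      proof (intro subset_antisym subsetI)
        fix b assume b: "b \<in> {b \<in> topspace B. w b \<in> D}"
        then obtain i x where ix: "i \<in> I" "x \<in> topspace (tdom (f i))" "b = tfun (f i) x" using surj by blast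
        then show "b \<in> (\<Union>i\<in>I. tfun (f i) ` ?D i)" using w[of i x] b by auto
      next
        fix b assume "b \<in> (\<Union>i\<in>I. tfun (f i) ` ?D i)"
        then obtain i x where ix: "i \<in> I" "x \<in> topspace (tdom (f i))" "b = tfun (f i) x" "tfun (e i) x \<in> D"
          by blast
        then show "b \<in> {b \<in> topspace B. w b \<in> D}"
          using w[of i x] tfun_in_topspace[of "f i" x] f[OF ix(1)] by simp
      qed
      then show "closedin B {b \<in> topspace B. w b \<in> D}"
        using cl assms by (auto intro: closedin_Union)
    qed
    then have wA: "mk_map B W w \<in> hom_set C B W" using R W by (auto intro: mk_map_hom)
    show "\<exists>!d. d \<in> hom_set C B W \<and> (\<forall>i\<in>I. Cmp C d (f i) = e i)"
    proof (intro ex1I conjI ballI)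
      show "mk_map B W w \<in> hom_set C B W" by fact
      show "Cmp C (mk_map B W w) (f i) = e i" if i: "i \<in> I" for i
      proof (rule Arr_eqI)
        fix x assume "x \<in> topspace (tdom (Cmp C (mk_map B W w) (f i)))"
        then have x: "x \<in> topspace (tdom (f i))" by simp
        then have "tfun (f i) x \<in> topspace B" using f[OF i] tfun_in_topspace by metis
        then show "tfun (Cmp C (mk_map B W w) (f i)) x = tfun (e i) x" using x i w by simp
      qed (use wA f[OF i] e[OF i] in \<open>auto simp: hom_set_def intro: Cmp_Arr\<close>)
      fix d assume d: "d \<in> hom_set C B W \<and> (\<forall>i\<in>I. Cmp C d (f i) = e i)"
      show "d = mk_map B W w"
      proof (rule Arr_eqI)
        fix b assume "b \<in> topspace (tdom d)"
        then have b: "b \<in> topspace B" using d by (simp add: hom_set_def)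
        then obtain i x where ix: "i \<in> I" "x \<in> topspace (tdom (f i))" "b = tfun (f i) x" using surj by blast
        then have "tfun d b = tfun (Cmp C d (f i)) x" by simp
        also have "\<dots> = w b" using d ix w by simp
        finally show "tfun d b = tfun (mk_map B W w) b" using b by simp
      qed (use d wA in \<open>auto simp: hom_set_def\<close>)
    qed
  qed (use R in auto)
qed

text \<open>A jointly bijective finite family of maps is a coproduct: it is jointly surjective, hence
  effective epimorphic, and bijectivity makes every family of maps on its members compatible.\<close>

lemma coproductI:
  assumes "finite I" "P \<in> K"
    and T: "\<And>i. i \<in> I \<Longrightarrow> T i \<in> K" and \<iota>: "\<And>i. i \<in> I \<Longrightarrow> \<iota> i \<in> hom_set C (T i) P"
    and surj: "topspace P \<subseteq> (\<Union>i\<in>I. tfun (\<iota> i) ` topspace (T i))"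
    and inj: "\<And>i j x y. \<lbrakk>i \<in> I; j \<in> I; x \<in> topspace (T i); y \<in> topspace (T j);
        tfun (\<iota> i) x = tfun (\<iota> j) y\<rbrakk> \<Longrightarrow> i = j \<and> x = y"
  shows "is_coproduct C I T P \<iota>"
proof -
  have \<iota>A: "\<iota> i \<in> Arr C" "tdom (\<iota> i) = T i" "tcod (\<iota> i) = P" if "i \<in> I" for i
    using \<iota>[OF that] by (auto simp: hom_set_def)
  have epi: "effective_epi_family C I \<iota> P"
    unfolding effective_epi_family_iff[OF assms(1)] using assms(2) surj \<iota>A by auto
  show ?thesis
    unfolding is_coproduct_def
  proof (intro conjI ballI allI impI)
    fix W e assume W: "W \<in> Obj C" and e: "\<forall>i\<in>I. e i \<in> hom_set C (T i) W"
    show "\<exists>!d. d \<in> hom_set C P W \<and> (\<forall>i\<in>I. Cmp C d (\<iota> i) = e i)"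
    proof (rule effective_epi_familyD[OF epi W])
      show "e i \<in> hom_set C (Dom C (\<iota> i)) W" if "i \<in> I" for i
        using e that \<iota>A by simp
      fix i j Z g h
      assume i: "i \<in> I" and j: "j \<in> I" and g: "g \<in> hom_set C Z (Dom C (\<iota> i))"
        and h: "h \<in> hom_set C Z (Dom C (\<iota> j))" and eq: "Cmp C (\<iota> i) g = Cmp C (\<iota> j) h"
      have ei: "e i \<in> Arr C" "tdom (e i) = T i" "tcod (e i) = W"
        "e j \<in> Arr C" "tdom (e j) = T j" "tcod (e j) = W"
        using e i j by (auto simp: hom_set_def)
      have gh: "g \<in> Arr C" "tdom g = Z" "tcod g = T i" "h \<in> Arr C" "tdom h = Z" "tcod h = T j"
        using g h \<iota>A[OF i] \<iota>A[OF j] by (auto simp: hom_set_def)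
      show "Cmp C (e i) g = Cmp C (e j) h"
      proof (rule Arr_eqI)
        fix z assume "z \<in> topspace (tdom (Cmp C (e i) g))"
        then have z: "z \<in> topspace Z" using gh by simp
        then have "tfun g z \<in> topspace (T i)" "tfun h z \<in> topspace (T j)"
          using gh tfun_in_topspace by metis+
        moreover have "tfun (\<iota> i) (tfun g z) = tfun (\<iota> j) (tfun h z)"
          using arg_cong[OF eq, of "\<lambda>m. tfun m z"] z gh by simp
        ultimately have "i = j \<and> tfun g z = tfun h z" by (intro inj[OF i j])
        then show "tfun (Cmp C (e i) g) z = tfun (Cmp C (e j) h) z"
          using z gh by simp
      qed (use ei gh in \<open>auto intro: Cmp_Arr\<close>)
    qed
  qed (use assms in auto)
qed

text \<open>The universal property determines the underlying set. Maps to a two-point space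
  separate the summands, and a retraction onto a summand shows that its inclusion is injective.\<close>

lemma coproduct_points:
  assumes coprod: "is_coproduct C I T P \<iota>" and T: "\<And>i. i \<in> I \<Longrightarrow> T i \<in> K"
    and ij: "i \<in> I" "j \<in> I" and x: "x \<in> topspace (T i)" and y: "y \<in> topspace (T j)"
    and eq: "tfun (\<iota> i) x = tfun (\<iota> j) y"
  shows "i = j \<and> x = y"
proof -
  have \<iota>: "\<iota> k \<in> Arr C" "tdom (\<iota> k) = T k" "tcod (\<iota> k) = P" if "k \<in> I" for k
    using coprod that by (auto simp: is_coproduct_def hom_set_def)
  have univ: "\<exists>d. d \<in> hom_set C P W \<and> (\<forall>k\<in>I. Cmp C d (\<iota> k) = e k)"
    if "W \<in> K" "\<And>k. k \<in> I \<Longrightarrow> e k \<in> hom_set C (T k) W" for W e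
    using coprod[unfolded is_coproduct_def, THEN conjunct2, THEN conjunct2, rule_format, of W e] that
    by auto
  have test: "tfun (e i) x = tfun (e j) y"
    if W: "W \<in> K" "\<And>k. k \<in> I \<Longrightarrow> e k \<in> hom_set C (T k) W" for W e
  proof -
    obtain d where d: "\<forall>k\<in>I. Cmp C d (\<iota> k) = e k" using univ[OF W] by blast
    have "tfun (e i) x = tfun d (tfun (\<iota> i) x)"
      using d ij x \<iota>[OF ij(1)] Cmp_simps(3)[of x "\<iota> i" d] by simp
    also have "\<dots> = tfun (e j) y"
      unfolding eq using d ij y \<iota>[OF ij(2)] Cmp_simps(3)[of y "\<iota> j" d] by simp
    finally show ?thesis .
  qed
  have "i = j"
  proof (rule ccontr)
    assume ne: "i \<noteq> j"
    obtain a b :: 'a where ab: "a \<noteq> b" using two_points by blast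
    let ?W = "discrete_topology {a, b}"
    let ?e = "\<lambda>k. mk_map (T k) ?W (\<lambda>_. if k = i then a else b)"
    have "?W \<in> K" by (rule discrete) simp
    then have "tfun (?e i) x = tfun (?e j) y"
      using T by (intro test[of ?W]) (auto intro!: constant_hom)
    then show False using x y ne ab by simp
  qed
  moreover have "x = y"
  proof -
    \<comment> \<open>These data define a retraction onto the summand \<open>T i\<close>; the other summands are collapsed to \<open>x\<close>.\<close>
    let ?e = "\<lambda>k. mk_map (T k) (T i) (if k = i then (\<lambda>z. z) else (\<lambda>_. x))"
    have "tfun (?e i) x = tfun (?e j) y"
    proof (rule test[of "T i" ?e])
      show "T i \<in> K" using T ij by simp
      show "?e k \<in> hom_set C (T k) (T i)" if "k \<in> I" for k
        using T[OF that] T[OF ij(1)] x by (intro mk_map_hom) auto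
    qed
    then show ?thesis using x y \<open>i = j\<close> by simp
  qed
  ultimately show ?thesis by blast
qed

lemma sheaf_preserves_finite_products:
  assumes X: "is_presheaf C X" and sheaf: "is_sheaf C (coherent_topology C) X"
  shows "preserves_finite_products C X"
  unfolding preserves_finite_products_def
proof (intro allI impI, elim conjE)
  interpret presheaf C X by unfold_locales (fact X)
  fix I :: "nat set" and T P \<iota>
  assume I: "finite I" and T: "\<forall>i\<in>I. T i \<in> Obj C" and coprod: "is_coproduct C I T P \<iota>"
  show "bij_betw (\<lambda>x. \<lambda>i\<in>I. Res X (\<iota> i) x) (Sec X P) (\<Pi>\<^sub>E i\<in>I. Sec X (T i))"
  proof (rule coherent_sheaf_bij_betw_coproduct[OF sheaf I coprod])
    fix i j g h
    assume ij: "i \<in> I" "j \<in> I" and "g \<in> Arr C" "h \<in> Arr C" "Dom C g = Dom C h"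
      "Cod C g = T i" "Cod C h = T j" and eq: "Cmp C (\<iota> i) g = Cmp C (\<iota> j) h"
    then have gh: "g \<in> Arr C" "h \<in> Arr C" "tdom g = tdom h" "tcod g = T i" "tcod h = T j" by auto
    have pts: "i = j \<and> tfun g z = tfun h z" if z: "z \<in> topspace (tdom g)" for z
    proof (rule coproduct_points[OF coprod _ ij])
      show "tfun g z \<in> topspace (T i)" "tfun h z \<in> topspace (T j)"
        using gh z tfun_in_topspace by metis+
      show "tfun (\<iota> i) (tfun g z) = tfun (\<iota> j) (tfun h z)"
        using arg_cong[OF eq, of "\<lambda>m. tfun m z"] z gh by simp
    qed (use T in auto)
    show "i = j \<and> g = h \<or> effective_epi_family C ({}::nat set) \<iota> (Dom C g)"
    proof (cases "topspace (tdom g) = {}")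
      case True
      then show ?thesis using gh by (subst effective_epi_family_iff) (auto simp: Arr_iff)
    next
      case False
      then have "i = j" using pts by blast
      moreover have "g = h" using gh pts \<open>i = j\<close> by (intro Arr_eqI) auto
      ultimately show ?thesis by blast
    qed
  qed
qed

lemma sheaf_equalizers:
  assumes X: "is_presheaf C X" and sheaf: "is_sheaf C (coherent_topology C) X"
  shows "surjections_give_equalizers C X"
  unfolding surjections_give_equalizers_def
proof (intro ballI allI impI)
  interpret presheaf C X by unfold_locales (fact X)
  fix \<pi> P p q assume \<pi>: "\<pi> \<in> Arr C" "surjection \<pi>" and pb: "is_pullback C \<pi> \<pi> P p q"
  show "is_set_equalizer (Sec X (Cod C \<pi>)) (Res X \<pi>) (Sec X (Dom C \<pi>)) (Res X p) (Res X q)"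
  proof (rule coherent_sheaf_equalizer[OF sheaf \<pi>(1) _ pb])
    show "effective_epi_family C {0::nat} (\<lambda>_. \<pi>) (Cod C \<pi>)"
      using \<pi> by (subst effective_epi_family_iff) (auto simp: surjection_def Arr_iff)
  qed
qed

definition covering_sieves :: "'a topology \<Rightarrow> 'a tmap set set" where
  "covering_sieves B = {S. is_sieve C B S \<and> (\<exists>F\<subseteq>S. covers F B)}"

lemma sieve_Arr: "is_sieve C B S \<Longrightarrow> f \<in> S \<Longrightarrow> f \<in> Arr C \<and> tcod f = B"
  by (auto simp: is_sieve_def)

text \<open>Stability under pullback is the refinement property. Local character holds because
  jointly surjective families compose.\<close>

lemma grothendieck_topology_covering_sieves: "grothendieck_topology C covering_sieves"
  unfolding grothendieck_topology_def
proof (intro conjI ballI allI impI)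
  fix B S assume "S \<in> covering_sieves B"
  then show "is_sieve C B S" by (simp add: covering_sieves_def)
next
  fix B assume B: "B \<in> Obj C"
  have "is_sieve C B (max_sieve C B)"
    by (auto simp: is_sieve_def max_sieve_def intro: Cmp_Arr)
  moreover have "{Ident C B} \<subseteq> max_sieve C B"
    using Ident_Arr[OF B] by (simp add: max_sieve_def)
  moreover have "covers {Ident C B} B"
    by (auto simp: covers_def full_Top_def)
  ultimately show "max_sieve C B \<in> covering_sieves B" by (auto simp: covering_sieves_def)
next
  fix B S g assume B: "B \<in> Obj C" and S: "S \<in> covering_sieves B" and g: "g \<in> Arr C" "Cod C g = B"
  from S obtain F where sieve: "is_sieve C B S" and F: "F \<subseteq> S" "covers F B"
    by (auto simp: covering_sieves_def)
  have "F \<subseteq> Arr C" using F sieve by (auto simp: is_sieve_def)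
  then obtain F' where F': "covers F' (tdom g)" "F' \<subseteq> Arr C"
    "\<And>f'. f' \<in> F' \<Longrightarrow> \<exists>f\<in>F. \<exists>h\<in>Arr C. tcod h = tdom f \<and> Cmp C g f' = Cmp C f h"
    using refinement[of B F g] B F(2) g by auto
  have "F' \<subseteq> pullback_sieve C g S"
  proof
    fix f' assume f': "f' \<in> F'"
    then obtain f h where "f \<in> F" "h \<in> Arr C" "tcod h = tdom f" "Cmp C g f' = Cmp C f h"
      using F'(3) by blast
    then have "Cmp C g f' \<in> S" using F(1) sieve by (auto simp: is_sieve_def)
    then show "f' \<in> pullback_sieve C g S"
      using f' F' by (auto simp: pullback_sieve_def covers_def)
  qed
  then show "pullback_sieve C g S \<in> covering_sieves (Dom C g)"
    using is_sieve_pullback[of g S] sieve g F'(1) by (auto simp: covering_sieves_def)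
next
  fix B S R
  assume S: "S \<in> covering_sieves B"
    and R: "is_sieve C B R \<and> (\<forall>f\<in>S. pullback_sieve C f R \<in> covering_sieves (Dom C f))"
  from S obtain F where sieve: "is_sieve C B S" and F: "F \<subseteq> S" "covers F B"
    by (auto simp: covering_sieves_def)
  have "\<forall>f\<in>F. \<exists>G. G \<subseteq> pullback_sieve C f R \<and> covers G (tdom f)"
  proof
    fix f assume "f \<in> F"
    then have "pullback_sieve C f R \<in> covering_sieves (tdom f)" using R F(1) by auto
    then show "\<exists>G. G \<subseteq> pullback_sieve C f R \<and> covers G (tdom f)"
      unfolding covering_sieves_def by blast
  qed
  then obtain G where G: "\<And>f. f \<in> F \<Longrightarrow> G f \<subseteq> pullback_sieve C f R \<and> covers (G f) (tdom f)"
    by metis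
  let ?H = "\<Union>f\<in>F. Cmp C f ` G f"
  have "?H \<subseteq> R" using G by (auto simp: pullback_sieve_def)
  moreover have "covers ?H B"
    unfolding covers_def
  proof (intro conjI ballI subsetI)
    show "finite ?H" using F G by (auto simp: covers_def)
    show "tcod h = B" if "h \<in> ?H" for h using that F by (auto simp: covers_def)
    fix b assume "b \<in> topspace B"
    then obtain f x where f: "f \<in> F" "x \<in> topspace (tdom f)" "b = tfun f x"
      using F(2) unfolding covers_def by blast
    then obtain g y where g: "g \<in> G f" "y \<in> topspace (tdom g)" "x = tfun g y"
      using G[OF f(1)] unfolding covers_def by blast
    then have "b = tfun (Cmp C f g) y" using f by simp
    then show "b \<in> (\<Union>h\<in>?H. tfun h ` topspace (tdom h))" using f(1) g by fastforce
  qed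
  ultimately show "R \<in> covering_sieves B" using R by (auto simp: covering_sieves_def)
qed

lemma coherent_topology_subset: "coherent_topology C B \<subseteq> covering_sieves B"
proof (rule coherent_topology_least(2)[OF grothendieck_topology_covering_sieves])
  show "contains_finite_effective_epis C covering_sieves"
    unfolding contains_finite_effective_epis_def
  proof (intro allI impI, elim conjE)
    fix I :: "nat set" and f B assume I: "finite I" and "effective_epi_family C I f B"
    then have f: "\<And>i. i \<in> I \<Longrightarrow> f i \<in> Arr C \<and> tcod (f i) = B"
      and surj: "topspace B \<subseteq> (\<Union>i\<in>I. tfun (f i) ` topspace (tdom (f i)))"
      by (auto simp: effective_epi_family_iff)
    have "f ` I \<subseteq> generated_sieve C I f"
    proof (intro image_subsetI)
      fix i assume i: "i \<in> I"
      let ?id = "Ident C (tdom (f i))"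
      have "tdom (f i) \<in> Obj C" using f[OF i] by (simp add: Arr_iff)
      then have "f i = Cmp C (f i) ?id" "?id \<in> Arr C" "Cod C ?id = Dom C (f i)"
        using f[OF i] Cmp_Ident[of "f i"] Ident_Arr by auto
      then show "f i \<in> generated_sieve C I f" using i unfolding generated_sieve_def by blast
    qed
    moreover have "covers (f ` I) B" using I f surj by (auto simp: covers_def)
    ultimately show "generated_sieve C I f \<in> covering_sieves B"
      using f by (auto simp: covering_sieves_def intro!: is_sieve_generated)
  qed
qed

text \<open>It suffices to find a section \<open>s\<close> that is right on a finite jointly surjective family \<open>F\<close> in the
  sieve, provided that sections are determined by their restrictions to such families: for any
  other arrow \<open>k\<close> of the sieve, \<open>F\<close> refined along \<open>k\<close> covers the source of \<open>k\<close>, and on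
  each member of this refinement both candidates restrict to a value prescribed by \<open>F\<close>.\<close>

lemma is_sheafI:
  assumes X: "is_presheaf C X"
    and separated: "\<And>F B x y. \<lbrakk>B \<in> K; F \<subseteq> Arr C; covers F B; x \<in> Sec X B; y \<in> Sec X B;
        \<And>f. f \<in> F \<Longrightarrow> Res X f x = Res X f y\<rbrakk> \<Longrightarrow> x = y"
    and glue: "\<And>S B x. \<lbrakk>B \<in> K; S \<in> covering_sieves B; \<And>f. f \<in> S \<Longrightarrow> x f \<in> Sec X (tdom f);
        \<And>f g. \<lbrakk>f \<in> S; g \<in> Arr C; tcod g = tdom f\<rbrakk> \<Longrightarrow> Res X g (x f) = x (Cmp C f g)\<rbrakk>
        \<Longrightarrow> \<exists>F s. F \<subseteq> S \<and> covers F B \<and> s \<in> Sec X B \<and> (\<forall>f\<in>F. Res X f s = x f)"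
  shows "is_sheaf C (coherent_topology C) X"
  unfolding is_sheaf_def
proof (intro ballI allI impI, elim conjE)
  interpret presheaf C X by unfold_locales (fact X)
  fix B S x
  assume B: "B \<in> Obj C" and S0: "S \<in> coherent_topology C B"
    and x: "\<forall>f\<in>S. x f \<in> Sec X (Dom C f)"
    and compat: "\<forall>f\<in>S. \<forall>g\<in>Arr C. Cod C g = Dom C f \<longrightarrow> Res X g (x f) = x (Cmp C f g)"
  have S: "S \<in> covering_sieves B" using S0 coherent_topology_subset by blast
  then have sieve: "is_sieve C B S" by (simp add: covering_sieves_def)
  obtain F s where F: "F \<subseteq> S" "covers F B" and s: "s \<in> Sec X B" "\<And>f. f \<in> F \<Longrightarrow> Res X f s = x f"
    using glue[of B S x] B S x compat by auto
  have FA: "F \<subseteq> Arr C" using F sieve_Arr[OF sieve] by blast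
  have "Res X k s = x k" if k: "k \<in> S" for k
  proof -
    have kA: "k \<in> Arr C" "tcod k = B" using sieve_Arr[OF sieve k] by auto
    obtain F' where F': "covers F' (tdom k)" "F' \<subseteq> Arr C"
      "\<And>f'. f' \<in> F' \<Longrightarrow> \<exists>f\<in>F. \<exists>h\<in>Arr C. tcod h = tdom f \<and> Cmp C k f' = Cmp C f h"
      using refinement[of B F k] B F(2) FA kA by auto
    show ?thesis
    proof (rule separated[OF _ F'(2,1)])
      show "tdom k \<in> K" using kA by (simp add: Arr_iff)
      show "Res X k s \<in> Sec X (tdom k)" using Res_in_Sec[of k s] kA s by simp
      show "x k \<in> Sec X (tdom k)" using x k by simp
      fix f' assume f': "f' \<in> F'"
      then obtain f h where fh: "f \<in> F" "h \<in> Arr C" "tcod h = tdom f" "Cmp C k f' = Cmp C f h"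
        using F'(3) by blast
      have f'A: "f' \<in> Arr C" "tcod f' = tdom k" using f' F' by (auto simp: covers_def)
      have fA: "f \<in> Arr C" "tcod f = B" using fh(1) FA F(2) by (auto simp: covers_def)
      have "Res X f' (Res X k s) = Res X (Cmp C k f') s"
        using Res_Cmp[of f' k s] f'A kA s by simp
      also have "\<dots> = Res X h (Res X f s)"
        unfolding fh(4) using Res_Cmp[of h f s] fh fA s by simp
      also have "\<dots> = Res X h (x f)" using s fh by simp
      also have "\<dots> = x (Cmp C f h)" using compat fh F by auto
      also have "\<dots> = Res X f' (x k)" unfolding fh(4)[symmetric] using compat k f'A by simp
      finally show "Res X f' (Res X k s) = Res X f' (x k)" .
    qed
  qed
  moreover have "s = t" if "t \<in> Sec X B" "\<forall>f\<in>S. Res X f t = x f" for t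
    by (rule separated[OF _ FA F(2)]) (use B s that F in auto)
  ultimately show "\<exists>!s. s \<in> Sec X B \<and> (\<forall>f\<in>S. Res X f s = x f)"
    using s by metis
qed

lemma preserves_finite_products_bij:
  fixes I :: "nat set"
  assumes "preserves_finite_products C X" "finite I" "\<And>i. i \<in> I \<Longrightarrow> T i \<in> K" "is_coproduct C I T P \<iota>"
  shows "bij_betw (\<lambda>x. \<lambda>i\<in>I. Res X (\<iota> i) x) (Sec X P) (\<Pi>\<^sub>E i\<in>I. Sec X (T i))"
  using assms unfolding preserves_finite_products_def by simp

lemma preserves_finite_products_eqI:
  fixes I :: "nat set"
  assumes X: "preserves_finite_products C X" "finite I" "\<And>i. i \<in> I \<Longrightarrow> T i \<in> K" "is_coproduct C I T P \<iota>"
    and xy: "x \<in> Sec X P" "y \<in> Sec X P" and eq: "\<And>i. i \<in> I \<Longrightarrow> Res X (\<iota> i) x = Res X (\<iota> i) y"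
  shows "x = y"
proof (rule inj_onD[OF bij_betw_imp_inj_on[OF preserves_finite_products_bij[OF X]] _ xy])
  show "(\<lambda>i\<in>I. Res X (\<iota> i) x) = (\<lambda>i\<in>I. Res X (\<iota> i) y)"
    by (rule restrict_ext) (rule eq)
qed

lemma preserves_finite_products_glue:
  fixes I :: "nat set"
  assumes X: "preserves_finite_products C X" "finite I" "\<And>i. i \<in> I \<Longrightarrow> T i \<in> K" "is_coproduct C I T P \<iota>"
    and y: "\<And>i. i \<in> I \<Longrightarrow> y i \<in> Sec X (T i)"
  obtains s where "s \<in> Sec X P" "\<And>i. i \<in> I \<Longrightarrow> Res X (\<iota> i) s = y i"
proof -
  have "restrict y I \<in> (\<Pi>\<^sub>E i\<in>I. Sec X (T i))"
    using y by (intro restrict_PiE_iff[THEN iffD2]) blast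
  then have "restrict y I \<in> (\<lambda>x. \<lambda>i\<in>I. Res X (\<iota> i) x) ` Sec X P"
    using bij_betw_imp_surj_on[OF preserves_finite_products_bij[OF X]] by simp
  then obtain s where s: "s \<in> Sec X P" "restrict y I = (\<lambda>i\<in>I. Res X (\<iota> i) s)" by blast
  show ?thesis
  proof (rule that[OF s(1)])
    show "Res X (\<iota> i) s = y i" if "i \<in> I" for i
      using fun_cong[OF s(2), of i] that by simp
  qed
qed

end

section \<open>Compact Hausdorff and profinite spaces\<close>

lemma infinite_two_points:
  assumes "infinite (UNIV :: 'a set)"
  shows "\<exists>a b :: 'a. a \<noteq> b"
  using assms by (metis UNIV_eq_I finite.emptyI finite.insertI singletonI)

text \<open>The flag selects between compact Hausdorff and profinite spaces, which are treated together.\<close>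

definition comp_haus :: "bool \<Rightarrow> 'a topology \<Rightarrow> bool" where
  "comp_haus td T \<longleftrightarrow> compact_space T \<and> Hausdorff_space T \<and> (td \<longrightarrow> totally_disconnected T)"

lemma CompHaus_eq: "CompHaus = full_Top {T. comp_haus False T}"
  and Profinite_eq: "Profinite = full_Top {T. comp_haus True T}"
  by (simp_all add: CompHaus_def Profinite_def comp_haus_def)

lemma comp_haus_homeomorphic:
  assumes T: "comp_haus td T" and h: "homeomorphic_map T T' \<phi>"
  shows "comp_haus td T'"
proof -
  obtain \<psi> where hm: "homeomorphic_maps T T' \<phi> \<psi>" using h homeomorphic_map_maps by blast
  have "T homeomorphic_space T'" using h homeomorphic_map_imp_homeomorphic_space by blast
  then have "compact_space T'" "Hausdorff_space T'"
    using T homeomorphic_compact_space homeomorphic_Hausdorff_space by (auto simp: comp_haus_def)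
  moreover have "totally_disconnected T'" if td
    using T that hm
    by (intro totally_disconnected_jointly_injective[of "{()}" T' "\<lambda>_. T" "\<lambda>_. \<psi>"])
       (auto simp: comp_haus_def homeomorphic_maps_def, metis)
  ultimately show ?thesis by (simp add: comp_haus_def)
qed

lemma clopen_separating_maps:
  assumes U: "openin B U" "closedin B U" "b \<in> U" "U \<inter> A = {}" and ab: "a0 \<noteq> a1"
  shows "\<exists>u v. continuous_map B (discrete_topology {a0, a1}) u \<and> continuous_map B (discrete_topology {a0, a1}) v
    \<and> (\<forall>a\<in>A. u a = v a) \<and> u b \<noteq> v b"
proof -
  let ?v = "\<lambda>x. if x \<in> U then a1 else a0"
  have UB: "U \<subseteq> topspace B" using U openin_subset by blast
  have "continuous_map B (discrete_topology {a0, a1}) ?v"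
    unfolding continuous_map
  proof (intro conjI allI impI)
    fix V
    have "{x \<in> topspace B. ?v x \<in> V} =
        (if a1 \<in> V then U else {}) \<union> (if a0 \<in> V then topspace B - U else {})"
      using UB by auto
    then show "openin B {x \<in> topspace B. ?v x \<in> V}" using U by (auto intro: openin_Un)
  qed auto
  then show ?thesis
    using U ab by (intro exI[of _ "\<lambda>_. a0"] exI[of _ ?v]) auto
qed

text \<open>A Urysohn function \<open>f\<close> that vanishes on \<open>A\<close> differs from the constant \<open>0\<close> at \<open>b\<close>. The unit interval
  may have too many points to be a space on \<open>'a\<close>, but the image of \<open>f\<close> does not: choosing
  preimages embeds it into \<open>B\<close>.\<close>

lemma compact_Hausdorff_separating_maps:
  fixes B :: "'a topology"
  assumes B: "compact_space B" "Hausdorff_space B" and A: "closedin B A" "A \<noteq> {}"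
    and b: "b \<in> topspace B" "b \<notin> A"
  shows "\<exists>W :: 'a topology. compact_space W \<and> Hausdorff_space W \<and> (\<exists>u v. continuous_map B W u \<and> continuous_map B W v
    \<and> (\<forall>a\<in>A. u a = v a) \<and> u b \<noteq> v b)"
proof -
  have "normal_space B" using B compact_Hausdorff_or_regular_imp_normal_space by blast
  moreover have "closedin B {b}" using B b by (simp add: closedin_Hausdorff_sing_eq)
  ultimately obtain f where f: "continuous_map B euclideanreal f" "f ` A \<subseteq> {0::real}" "f ` {b} \<subseteq> {1}"
    using Urysohn_lemma_alt[OF _ A(1), of "{b}" 0 1] b by (auto simp: disjnt_iff)
  let ?D = "subtopology euclideanreal (f ` topspace B)"
  have fD: "continuous_map B ?D f" using f(1) by (simp add: continuous_map_in_subtopology)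
  have tD: "topspace ?D = f ` topspace B" by simp
  have "compactin euclideanreal (f ` topspace B)"
    using image_compactin[OF _ f(1), of "topspace B"] B by (simp add: compact_space_def)
  then have D: "comp_haus False ?D"
    unfolding comp_haus_def
    by (simp add: compact_space_subtopology Hausdorff_space_subtopology Hausdorff_space_euclidean)
  define \<phi> where "\<phi> = inv_into (topspace B) f"
  have inj: "inj_on \<phi> (topspace ?D)" unfolding tD \<phi>_def by (rule inj_on_inv_into) simp
  then obtain W where W: "homeomorphic_map ?D W \<phi>" by (rule homeomorphic_copy)
  have \<phi>: "continuous_map ?D W \<phi>" using W homeomorphic_imp_continuous_map by blast
  obtain a where a: "a \<in> A" using A by blast
  have aB: "a \<in> topspace B" using a A closedin_subset by blast
  have "continuous_map B W (\<phi> \<circ> f)" using fD \<phi> by (rule continuous_map_compose)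
  moreover have "continuous_map B W (\<lambda>_. \<phi> (f a))"
    using continuous_map_image_subset_topspace[OF \<phi>] aB by auto
  moreover have "\<phi> (f b) \<noteq> \<phi> (f a)"
  proof
    assume "\<phi> (f b) = \<phi> (f a)"
    then have "f b = f a" using inj b aB unfolding tD by (auto dest: inj_onD)
    then show False using f(2,3) a by auto
  qed
  moreover have "(\<phi> \<circ> f) c = \<phi> (f a)" if "c \<in> A" for c
  proof -
    have "f c = 0" "f a = 0" using f(2) a that by auto
    then show ?thesis by simp
  qed
  moreover have "compact_space W" "Hausdorff_space W"
    using comp_haus_homeomorphic[OF D W] by (auto simp: comp_haus_def)
  ultimately show ?thesis
    by (intro exI[of _ W] conjI exI[of _ "\<phi> \<circ> f"] exI[of _ "\<lambda>_. \<phi> (f a)"]) auto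
qed

locale comp_haus_category = full_category "{T :: 'a topology. comp_haus td T}" for td +
  assumes infinite_points: "infinite (UNIV :: 'a set)"
begin

abbreviation K where "K \<equiv> {T :: 'a topology. comp_haus td T}"

lemma homeomorphic_object:
  assumes E: "comp_haus td E" and \<phi>: "inj \<phi>"
  obtains P \<psi> where "P \<in> K" "homeomorphic_maps E P (\<phi> :: 'x \<Rightarrow> 'a) \<psi>"
proof -
  have "inj_on \<phi> (topspace E)" using \<phi> by (rule inj_on_subset) simp
  then obtain P where P: "homeomorphic_map E P \<phi>" by (rule homeomorphic_copy)
  then show ?thesis
    using that comp_haus_homeomorphic[OF E P] homeomorphic_map_maps by blast
qed

lemma inj_square: "\<exists>\<phi> :: 'a \<times> 'a \<Rightarrow> 'a. inj \<phi>"
proof -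
  have "\<exists>\<phi>. bij_betw \<phi> ((UNIV :: 'a set) \<times> (UNIV :: 'a set)) (UNIV :: 'a set)"
    using card_of_Times_same_infinite[OF infinite_points] unfolding card_of_ordIso .
  then show ?thesis by (auto simp: bij_betw_def)
qed

lemma inj_nat_times: "\<exists>\<phi> :: nat \<times> 'a \<Rightarrow> 'a. inj \<phi>"
proof -
  obtain \<phi> :: "'a \<times> 'a \<Rightarrow> 'a" where "inj \<phi>" using inj_square by blast
  moreover obtain e :: "nat \<Rightarrow> 'a" where "inj e"
    using infinite_countable_subset[OF infinite_points] by blast
  ultimately have "inj (\<lambda>(n, x). \<phi> (e n, x))"
    by (auto intro!: injI dest!: injD[of \<phi>] injD[of e])
  then show ?thesis by blast
qed

text \<open>The usual subspace of the product, transported to \<open>'a\<close>. It is totally disconnected if both factors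
  are, as the two projections are jointly injective.\<close>

lemma pullback_exists:
  assumes f: "f \<in> Arr C" and g: "g \<in> Arr C" and fg: "tcod f = tcod g"
  obtains P p q where "is_pullback C f g P p q"
    "\<And>x y. \<lbrakk>x \<in> topspace (tdom f); y \<in> topspace (tdom g); tfun f x = tfun g y\<rbrakk>
      \<Longrightarrow> \<exists>z\<in>topspace P. tfun p z = x \<and> tfun q z = y"
proof -
  let ?X = "tdom f" and ?Y = "tdom g"
  define E where "E = subtopology (prod_topology ?X ?Y) {(x, y). tfun f x = tfun g y}"
  have XY: "?X \<in> K" "?Y \<in> K" "tcod g \<in> K" and cont: "continuous_map ?X (tcod g) (tfun f)"
    "continuous_map ?Y (tcod g) (tfun g)"
    using f g fg by (auto simp: Arr_iff)
  then have CH: "compact_space ?X" "compact_space ?Y" "Hausdorff_space ?X" "Hausdorff_space ?Y"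
    "Hausdorff_space (tcod g)"
    by (auto simp: comp_haus_def)
  have E: "compact_space E" "Hausdorff_space E" "continuous_map E ?X fst" "continuous_map E ?Y snd"
    "topspace E = {(x, y). x \<in> topspace ?X \<and> y \<in> topspace ?Y \<and> tfun f x = tfun g y}"
    unfolding E_def by (fact compact_Hausdorff_fibre_product[OF CH cont])+
  have "totally_disconnected E" if td
  proof (rule totally_disconnected_jointly_injective)
    show "continuous_map E (if b then ?X else ?Y) (if b then fst else snd) \<and>
        totally_disconnected (if b then ?X else ?Y)" if "b \<in> UNIV" for b
      using \<open>td\<close> XY E(3,4) by (simp add: comp_haus_def)
    show "z = w" if "\<And>b. b \<in> UNIV \<Longrightarrow> (if b then fst else snd) z = (if b then fst else snd) w" for z w
      using that[of True] that[of False] by (simp add: prod_eq_iff)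
  qed
  then have "comp_haus td E" using E by (simp add: comp_haus_def)
  moreover obtain \<phi> :: "'a \<times> 'a \<Rightarrow> 'a" where "inj \<phi>" using inj_square by blast
  ultimately obtain P \<psi> where P: "P \<in> K" "homeomorphic_maps E P \<phi> \<psi>" by (rule homeomorphic_object)
  have \<phi>: "continuous_map E P \<phi>" and \<psi>: "continuous_map P E \<psi>"
    and \<psi>\<phi>: "\<And>z. z \<in> topspace E \<Longrightarrow> \<psi> (\<phi> z) = z" and \<phi>\<psi>: "\<And>w. w \<in> topspace P \<Longrightarrow> \<phi> (\<psi> w) = w"
    using P(2) by (auto simp: homeomorphic_maps_def)
  have \<phi>P: "\<phi> z \<in> topspace P" if "z \<in> topspace E" for z
    using \<phi> that continuous_map_image_subset_topspace by blast
  have \<psi>E: "\<psi> w \<in> topspace E" if "w \<in> topspace P" for w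
    using \<psi> that continuous_map_image_subset_topspace by blast
  define p where "p = mk_map P ?X (fst \<circ> \<psi>)"
  define q where "q = mk_map P ?Y (snd \<circ> \<psi>)"
  have p: "p \<in> hom_set C P ?X" "\<And>w. w \<in> topspace P \<Longrightarrow> tfun p w = fst (\<psi> w)"
    unfolding p_def using P(1) XY continuous_map_compose[OF \<psi> E(3)] by (auto intro!: mk_map_hom)
  have q: "q \<in> hom_set C P ?Y" "\<And>w. w \<in> topspace P \<Longrightarrow> tfun q w = snd (\<psi> w)"
    unfolding q_def using P(1) XY continuous_map_compose[OF \<psi> E(4)] by (auto intro!: mk_map_hom)
  have pA: "p \<in> Arr C" "tdom p = P" "tcod p = ?X" and qA: "q \<in> Arr C" "tdom q = P" "tcod q = ?Y"
    using p(1) q(1) by (auto simp: hom_set_def)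
  have commute: "Cmp C f p = Cmp C g q"
  proof (rule Arr_eqI)
    fix w assume "w \<in> topspace (tdom (Cmp C f p))"
    then have w: "w \<in> topspace P" using pA by simp
    then show "tfun (Cmp C f p) w = tfun (Cmp C g q) w"
      using \<psi>E[OF w] p(2) q(2) pA qA E(5) by (auto simp: case_prod_unfold)
  qed (use pA qA f g fg in \<open>auto intro: Cmp_Arr\<close>)
  have "is_pullback C f g P p q"
    unfolding is_pullback_def
  proof (intro conjI ballI impI)
    fix Z u v assume Z: "Z \<in> Obj C" and u: "u \<in> hom_set C Z (Dom C f)" and v: "v \<in> hom_set C Z (Dom C g)"
      and eq: "Cmp C f u = Cmp C g v"
    have uv: "u \<in> Arr C" "tdom u = Z" "tcod u = ?X" "v \<in> Arr C" "tdom v = Z" "tcod v = ?Y"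
      using u v by (auto simp: hom_set_def)
    have "continuous_map Z E (\<lambda>z. (tfun u z, tfun v z))"
      unfolding E_def
    proof (rule continuous_map_into_subtopology)
      show "continuous_map Z (prod_topology ?X ?Y) (\<lambda>z. (tfun u z, tfun v z))"
        using uv by (intro continuous_map_pairedI) (auto simp: Arr_iff)
      show "(\<lambda>z. (tfun u z, tfun v z)) \<in> topspace Z \<rightarrow> {(x, y). tfun f x = tfun g y}"
      proof
        fix z assume "z \<in> topspace Z"
        then show "(tfun u z, tfun v z) \<in> {(x, y). tfun f x = tfun g y}"
          using arg_cong[OF eq, of "\<lambda>m. tfun m z"] uv by simp
      qed
    qed
    then have dcont: "continuous_map Z E (\<lambda>z. (tfun u z, tfun v z))" .
    then have uvE: "(tfun u z, tfun v z) \<in> topspace E" if "z \<in> topspace Z" for z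
      using that continuous_map_image_subset_topspace by blast
    define d where "d = mk_map Z P (\<phi> \<circ> (\<lambda>z. (tfun u z, tfun v z)))"
    have d: "d \<in> hom_set C Z P" "\<And>z. z \<in> topspace Z \<Longrightarrow> tfun d z = \<phi> (tfun u z, tfun v z)"
      unfolding d_def using Z P(1) continuous_map_compose[OF dcont \<phi>] by (auto intro!: mk_map_hom)
    have dA: "d \<in> Arr C" "tdom d = Z" "tcod d = P" using d(1) by (auto simp: hom_set_def)
    show "\<exists>!d. d \<in> hom_set C Z P \<and> Cmp C p d = u \<and> Cmp C q d = v"
    proof (intro ex1I conjI)
      show "d \<in> hom_set C Z P" by fact
      show "Cmp C p d = u"
        by (rule Arr_eqI) (use dA pA uv d(2) p(2) \<phi>P uvE \<psi>\<phi> in \<open>auto intro: Cmp_Arr\<close>)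
      show "Cmp C q d = v"
        by (rule Arr_eqI) (use dA qA uv d(2) q(2) \<phi>P uvE \<psi>\<phi> in \<open>auto intro: Cmp_Arr\<close>)
      fix d' assume d': "d' \<in> hom_set C Z P \<and> Cmp C p d' = u \<and> Cmp C q d' = v"
      then have d'A: "d' \<in> Arr C" "tdom d' = Z" "tcod d' = P" by (auto simp: hom_set_def)
      show "d' = d"
      proof (rule Arr_eqI)
        fix z assume "z \<in> topspace (tdom d')"
        then have z: "z \<in> topspace Z" using d'A by simp
        have d'z: "tfun d' z \<in> topspace P" using tfun_in_topspace[OF d'A(1), of z] d'A z by simp
        have "fst (\<psi> (tfun d' z)) = tfun (Cmp C p d') z"
          using z d'A p(2)[OF d'z] by simp
        moreover have "snd (\<psi> (tfun d' z)) = tfun (Cmp C q d') z"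
          using z d'A q(2)[OF d'z] by simp
        ultimately have "\<psi> (tfun d' z) = (tfun u z, tfun v z)"
          using d' by (simp add: prod_eq_iff)
        then show "tfun d' z = tfun d z" using \<phi>\<psi>[OF d'z] d(2)[OF z] by simp
      qed (use d'A dA in auto)
    qed
  qed (use P p q commute in auto)
  moreover have "\<exists>z\<in>topspace P. tfun p z = x \<and> tfun q z = y"
    if "x \<in> topspace ?X" "y \<in> topspace ?Y" "tfun f x = tfun g y" for x y
  proof -
    have xy: "(x, y) \<in> topspace E" using that E(5) by simp
    show ?thesis
      using \<phi>P[OF xy] p(2)[OF \<phi>P[OF xy]] q(2)[OF \<phi>P[OF xy]] \<psi>\<phi>[OF xy] by (intro bexI[of _ "\<phi> (x, y)"]) auto
  qed
  ultimately show ?thesis by (rule that)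
qed

lemma refinement_by_pullback:
  assumes F: "covers F B" "F \<subseteq> Arr C" and g: "g \<in> Arr C" "tcod g = B"
  shows "\<exists>F'. covers F' (tdom g) \<and> F' \<subseteq> Arr C \<and>
        (\<forall>f'\<in>F'. \<exists>f\<in>F. \<exists>h\<in>Arr C. tcod h = tdom f \<and> Cmp C g f' = Cmp C f h)"
proof -
  define Q where "Q f p q \<longleftrightarrow> p \<in> Arr C \<and> tcod p = tdom g \<and> q \<in> Arr C \<and> tcod q = tdom f \<and>
      Cmp C g p = Cmp C f q \<and> (\<forall>b\<in>topspace (tdom g). \<forall>x\<in>topspace (tdom f). tfun g b = tfun f x \<longrightarrow>
        (\<exists>z\<in>topspace (tdom p). tfun p z = b))" for f p q
  have "\<exists>p q. Q f p q" if "f \<in> F" for f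
  proof -
    have f: "f \<in> Arr C" "tcod f = B" using F that by (auto simp: covers_def)
    have gf: "tcod g = tcod f" using f g by simp
    obtain P p q where pb: "is_pullback C g f P p q" and
      pts: "\<And>x y. \<lbrakk>x \<in> topspace (tdom g); y \<in> topspace (tdom f); tfun g x = tfun f y\<rbrakk>
      \<Longrightarrow> \<exists>z\<in>topspace P. tfun p z = x \<and> tfun q z = y"
      using pullback_exists[OF g(1) f(1) gf] by metis
    have pq: "p \<in> Arr C" "tcod p = tdom g" "tdom p = P" "q \<in> Arr C" "tcod q = tdom f" "Cmp C g p = Cmp C f q"
      using pb by (auto simp: is_pullback_def hom_set_def)
    have "\<exists>z\<in>topspace P. tfun p z = b"
      if "b \<in> topspace (tdom g)" "x \<in> topspace (tdom f)" "tfun g b = tfun f x" for b x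
      using pts[OF that] by blast
    then have "Q f p q" unfolding Q_def using pq by simp
    then show ?thesis by blast
  qed
  then obtain p q where Q: "\<And>f. f \<in> F \<Longrightarrow> Q f (p f) (q f)"
    by metis
  then have pq: "p f \<in> Arr C \<and> tcod (p f) = tdom g \<and> q f \<in> Arr C \<and>
      tcod (q f) = tdom f \<and> Cmp C g (p f) = Cmp C f (q f)" if "f \<in> F" for f
    using that unfolding Q_def by blast
  have "covers (p ` F) (tdom g)"
    unfolding covers_def
  proof (intro conjI subsetI)
    fix b assume b: "b \<in> topspace (tdom g)"
    then have "tfun g b \<in> topspace B" using g tfun_in_topspace by blast
    then obtain f x where "f \<in> F" "x \<in> topspace (tdom f)" "tfun g b = tfun f x"
      using F(1) unfolding covers_def by blast
    then obtain z where "z \<in> topspace (tdom (p f))" "tfun (p f) z = b"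
      using Q b unfolding Q_def by blast
    then show "b \<in> (\<Union>f\<in>p ` F. tfun f ` topspace (tdom f))" using \<open>f \<in> F\<close> by blast
  qed (use F pq in \<open>auto simp: covers_def\<close>)
  then show ?thesis using pq by (intro exI[of _ "p ` F"]) auto
qed

lemma separating_arrows:
  assumes B: "B \<in> K" and A: "closedin B A" and b: "b \<in> topspace B" "b \<notin> A"
  shows "\<exists>W\<in>K. \<exists>u v. continuous_map B W u \<and> continuous_map B W v \<and> (\<forall>a\<in>A. u a = v a) \<and> u b \<noteq> v b"
proof (cases "td \<or> A = {}")
  case True
  have "\<exists>U. openin B U \<and> closedin B U \<and> b \<in> U \<and> U \<inter> A = {}"
  proof (cases "A = {}")
    case True
    then show ?thesis using b by (intro exI[of _ "topspace B"]) auto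
  next
    case False
    with \<open>td \<or> A = {}\<close> B clopen_separation_totally_disconnected[OF _ _ _ A b]
    show ?thesis by (auto simp: comp_haus_def)
  qed
  then obtain U where U: "openin B U" "closedin B U" "b \<in> U" "U \<inter> A = {}" by blast
  obtain a0 a1 :: 'a where ab: "a0 \<noteq> a1"
    using infinite_two_points[OF infinite_points] by blast
  have "discrete_topology {a0, a1} \<in> K"
    by (simp add: comp_haus_def compact_space_discrete_topology totally_disconnected_discrete)
  then show ?thesis using clopen_separating_maps[OF U ab] by blast
next
  case False
  then show ?thesis
    using compact_Hausdorff_separating_maps[OF _ _ A _ b] B by (auto simp: comp_haus_def)
qed

end

sublocale comp_haus_category \<subseteq> compact_Hausdorff_category K
proof unfold_locales
  show "discrete_topology A \<in> K" if "finite A" for A :: "'a set"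
    using that by (simp add: comp_haus_def compact_space_discrete_topology totally_disconnected_discrete)
  show "\<exists>a b :: 'a. a \<noteq> b"
    using infinite_two_points[OF infinite_points] by blast
  show "compact_space T" "Hausdorff_space T" if "T \<in> K" for T
    using that by (auto simp: comp_haus_def)
  show "\<exists>W\<in>K. \<exists>u v. continuous_map B W u \<and> continuous_map B W v \<and> (\<forall>a\<in>A. u a = v a) \<and> u b \<noteq> v b"
    if "B \<in> K" "closedin B A" "b \<in> topspace B" "b \<notin> A" for B A b
    using that by (rule separating_arrows)
  show "\<exists>F'. covers F' (tdom g) \<and> F' \<subseteq> Arr C \<and>
      (\<forall>f'\<in>F'. \<exists>f\<in>F. \<exists>h\<in>Arr C. tcod h = tdom f \<and> Cmp C g f' = Cmp C f h)"
    if "covers F B" "F \<subseteq> Arr C" "g \<in> Arr C" "tcod g = B" for B F g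
    using that by (rule refinement_by_pullback)
qed

context comp_haus_category
begin

lemma coproduct_exists:
  fixes I :: "nat set"
  assumes I: "finite I" and T: "\<And>i. i \<in> I \<Longrightarrow> T i \<in> K"
  obtains P \<iota> where "is_coproduct C I T P \<iota>" "topspace P \<subseteq> (\<Union>i\<in>I. tfun (\<iota> i) ` topspace (T i))"
proof -
  let ?S = "sum_topology T I"
  have "comp_haus td ?S"
    using T I unfolding comp_haus_def
    by (auto intro!: compact_space_sum_topology Hausdorff_space_sum_topology totally_disconnected_sum_topology)
  moreover obtain \<phi> :: "nat \<times> 'a \<Rightarrow> 'a" where \<phi>: "inj \<phi>" using inj_nat_times by blast
  ultimately obtain P \<psi> where P: "P \<in> K" "homeomorphic_maps ?S P \<phi> \<psi>" by (rule homeomorphic_object)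
  define \<iota> where "\<iota> i = mk_map (T i) P (\<lambda>x. \<phi> (i, x))" for i
  have \<iota>: "\<iota> i \<in> hom_set C (T i) P" if "i \<in> I" for i
  proof -
    have "continuous_map ?S P \<phi>" using P by (simp add: homeomorphic_maps_def)
    then have "continuous_map (T i) P (\<phi> \<circ> (\<lambda>x. (i, x)))"
      using continuous_map_component_injection[OF that] continuous_map_compose by blast
    then show ?thesis unfolding \<iota>_def using T[OF that] P by (intro mk_map_hom) (auto simp: o_def)
  qed
  have surj: "topspace P \<subseteq> (\<Union>i\<in>I. tfun (\<iota> i) ` topspace (T i))"
  proof
    fix w assume w: "w \<in> topspace P"
    have "continuous_map P ?S \<psi>" using P by (simp add: homeomorphic_maps_def)
    then have "\<psi> w \<in> topspace ?S" using w continuous_map_image_subset_topspace by blast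
    then obtain i x where ix: "\<psi> w = (i, x)" "i \<in> I" "x \<in> topspace (T i)" by auto
    have "\<phi> (\<psi> w) = w" using P w by (simp add: homeomorphic_maps_def)
    then have "tfun (\<iota> i) x = w" using ix by (simp add: \<iota>_def)
    then show "w \<in> (\<Union>i\<in>I. tfun (\<iota> i) ` topspace (T i))" using ix by blast
  qed
  have "is_coproduct C I T P \<iota>"
  proof (rule coproductI[OF I P(1) T \<iota> surj])
    fix i j x y assume "i \<in> I" "j \<in> I" "x \<in> topspace (T i)" "y \<in> topspace (T j)"
      "tfun (\<iota> i) x = tfun (\<iota> j) y"
    then have "\<phi> (i, x) = \<phi> (j, y)" by (simp add: \<iota>_def)
    then show "i = j \<and> x = y" using injD[OF \<phi>] by blast
  qed
  then show ?thesis using surj by (rule that)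
qed

text \<open>A finite jointly surjective family is a coproduct decomposition followed by one surjection.\<close>

lemma cover_factors_through_coproduct:
  assumes F: "covers F B" "F \<subseteq> Arr C" and B: "B \<in> K"
  obtains I :: "nat set" and f P \<iota> \<pi> where "finite I" "f ` I = F" "is_coproduct C I (tdom \<circ> f) P \<iota>"
    "covers (\<iota> ` I) P" "\<pi> \<in> Arr C" "tdom \<pi> = P" "tcod \<pi> = B" "surjection \<pi>"
    "\<And>i. i \<in> I \<Longrightarrow> \<iota> i \<in> Arr C \<and> tdom (\<iota> i) = tdom (f i) \<and> tcod (\<iota> i) = P \<and> Cmp C \<pi> (\<iota> i) = f i"
proof -
  obtain n :: nat and f where f: "F = f ` {i. i < n}"
    using F(1) finite_imp_nat_seg_image_inj_on unfolding covers_def by metis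
  let ?I = "{i. i < n}"
  have fA: "f i \<in> Arr C" "tcod (f i) = B" if "i \<in> ?I" for i
    using F f that by (auto simp: covers_def)
  have T: "(tdom \<circ> f) i \<in> K" if "i \<in> ?I" for i using fA[OF that] unfolding Arr_iff by simp
  obtain P \<iota> where coprod: "is_coproduct C ?I (tdom \<circ> f) P \<iota>"
    and surj: "topspace P \<subseteq> (\<Union>i\<in>?I. tfun (\<iota> i) ` topspace ((tdom \<circ> f) i))"
    using coproduct_exists[of ?I "tdom \<circ> f"] T by blast
  have \<iota>: "\<iota> i \<in> Arr C" "tdom (\<iota> i) = tdom (f i)" "tcod (\<iota> i) = P" if "i \<in> ?I" for i
    using coprod that by (auto simp: is_coproduct_def hom_set_def)
  have "\<forall>W\<in>Obj C. \<forall>e. (\<forall>i\<in>?I. e i \<in> hom_set C ((tdom \<circ> f) i) W) \<longrightarrow>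
      (\<exists>!d. d \<in> hom_set C P W \<and> (\<forall>i\<in>?I. Cmp C d (\<iota> i) = e i))"
    using coprod unfolding is_coproduct_def by blast
  moreover have "B \<in> Obj C" using B by simp
  moreover have "\<forall>i\<in>?I. f i \<in> hom_set C ((tdom \<circ> f) i) B"
    using fA by (simp add: hom_set_def)
  ultimately have "\<exists>!d. d \<in> hom_set C P B \<and> (\<forall>i\<in>?I. Cmp C d (\<iota> i) = f i)" by blast
  then obtain \<pi> where \<pi>: "\<pi> \<in> hom_set C P B" and factor: "\<And>i. i \<in> ?I \<Longrightarrow> Cmp C \<pi> (\<iota> i) = f i"
    by blast
  have \<pi>A: "\<pi> \<in> Arr C" "tdom \<pi> = P" "tcod \<pi> = B" using \<pi> by (auto simp: hom_set_def)
  have "surjection \<pi>"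
    unfolding surjection_def
  proof
    show "tfun \<pi> ` topspace (tdom \<pi>) \<subseteq> topspace (tcod \<pi>)"
      using tfun_in_topspace[OF \<pi>A(1)] by blast
    show "topspace (tcod \<pi>) \<subseteq> tfun \<pi> ` topspace (tdom \<pi>)"
    proof
      fix b assume "b \<in> topspace (tcod \<pi>)"
      then obtain i x where i: "i \<in> ?I" and x: "x \<in> topspace (tdom (f i))" "b = tfun (f i) x"
        using F(1) \<pi>A unfolding covers_def f by blast
      have "b = tfun (Cmp C \<pi> (\<iota> i)) x" using factor[OF i] x by simp
      then have "b = tfun \<pi> (tfun (\<iota> i) x)" using x \<iota>[OF i] by simp
      moreover have "tfun (\<iota> i) x \<in> topspace P" using tfun_in_topspace[of "\<iota> i" x] \<iota>[OF i] x by simp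
      ultimately show "b \<in> tfun \<pi> ` topspace (tdom \<pi>)" using \<pi>A by blast
    qed
  qed
  moreover have "covers (\<iota> ` ?I) P"
    unfolding covers_def using surj \<iota> by auto
  ultimately show ?thesis
    using that[of ?I f P \<iota> \<pi>] f coprod \<pi>A factor \<iota> by simp
qed

text \<open>Write the given family as inclusions \<open>\<iota>\<^sub>i\<close> into a coproduct \<open>P\<close> followed by a surjection \<open>\<pi>\<close>.
  Restriction along \<open>\<pi>\<close> is injective by the equalizer condition and restriction to the summands
  by the product condition; so sections are determined on jointly surjective families. For
  existence, let \<open>y\<close> be the section on \<open>P\<close> glued from the given ones. It equalizes the
  projections \<open>p\<close>, \<open>q\<close> of the fibre product of \<open>\<pi>\<close> with itself: this can be tested on a
  jointly surjective family of arrows after which both \<open>p\<close> and \<open>q\<close> factor through inclusions, and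
  there both restrictions of \<open>y\<close> are the given section at \<open>\<pi> p = \<pi> q\<close>.\<close>

lemma is_sheaf_if_products_and_equalizers:
  assumes X: "is_presheaf C X" and prod: "preserves_finite_products C X"
    and equalizer: "surjections_give_equalizers C X"
  shows "is_sheaf C (coherent_topology C) X"
proof -
  interpret presheaf C X by unfold_locales (fact X)
  have eq: "is_set_equalizer (Sec X (tcod \<pi>)) (Res X \<pi>) (Sec X (tdom \<pi>)) (Res X p) (Res X q)"
    if "\<pi> \<in> Arr C" "surjection \<pi>" "is_pullback C \<pi> \<pi> P p q" for \<pi> P p q
    using equalizer that unfolding surjections_give_equalizers_def by simp
  have separated: "x = y"
    if B: "B \<in> K" and F: "F \<subseteq> Arr C" "covers F B" and xy: "x \<in> Sec X B" "y \<in> Sec X B"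
      and res: "\<And>f. f \<in> F \<Longrightarrow> Res X f x = Res X f y" for B F x y
  proof -
    obtain I :: "nat set" and f P \<iota> \<pi> where I: "finite I" "f ` I = F"
      and coprod: "is_coproduct C I (tdom \<circ> f) P \<iota>"
      and \<pi>: "\<pi> \<in> Arr C" "tdom \<pi> = P" "tcod \<pi> = B" "surjection \<pi>"
      and \<iota>: "\<And>i. i \<in> I \<Longrightarrow> \<iota> i \<in> Arr C \<and> tdom (\<iota> i) = tdom (f i) \<and> tcod (\<iota> i) = P \<and> Cmp C \<pi> (\<iota> i) = f i"
      using cover_factors_through_coproduct[OF F(2,1) B] by metis
    obtain W p q where pb: "is_pullback C \<pi> \<pi> W p q" using pullback_exists[OF \<pi>(1) \<pi>(1) refl] by metis
    have inj: "inj_on (Res X \<pi>) (Sec X B)"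
      using eq[OF \<pi>(1,4) pb] \<pi>(3) by (simp add: is_set_equalizer_def bij_betw_def)
    have "Res X \<pi> x = Res X \<pi> y"
    proof (rule preserves_finite_products_eqI[OF prod I(1) _ coprod])
      show "(tdom \<circ> f) i \<in> K" if "i \<in> I" for i using \<iota>[OF that] by (auto simp: Arr_iff)
      show "Res X \<pi> x \<in> Sec X P" "Res X \<pi> y \<in> Sec X P"
        using Res_in_Sec[OF \<pi>(1)] \<pi> xy by auto
      fix i assume i: "i \<in> I"
      have "Res X (\<iota> i) (Res X \<pi> z) = Res X (f i) z" if "z \<in> Sec X B" for z
        using Res_Cmp[of "\<iota> i" \<pi> z] \<iota>[OF i] \<pi> that by simp
      then show "Res X (\<iota> i) (Res X \<pi> x) = Res X (\<iota> i) (Res X \<pi> y)"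
        using xy res[of "f i"] I i by auto
    qed
    then show "x = y" using inj xy by (auto dest: inj_onD)
  qed
  show ?thesis
  proof (rule is_sheafI[OF X separated])
    fix S B x
    assume B: "B \<in> K" and S: "S \<in> covering_sieves B"
      and x: "\<And>f. f \<in> S \<Longrightarrow> x f \<in> Sec X (tdom f)"
      and compat: "\<And>f g. \<lbrakk>f \<in> S; g \<in> Arr C; tcod g = tdom f\<rbrakk> \<Longrightarrow> Res X g (x f) = x (Cmp C f g)"
    from S obtain F where sieve: "is_sieve C B S" and F: "F \<subseteq> S" "covers F B"
      by (auto simp: covering_sieves_def)
    have FA: "F \<subseteq> Arr C" using F sieve_Arr[OF sieve] by blast
    obtain I :: "nat set" and f P \<iota> \<pi> where I: "finite I" "f ` I = F"
      and coprod: "is_coproduct C I (tdom \<circ> f) P \<iota>" and \<iota>_covers: "covers (\<iota> ` I) P"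
      and \<pi>: "\<pi> \<in> Arr C" "tdom \<pi> = P" "tcod \<pi> = B" "surjection \<pi>"
      and \<iota>: "\<And>i. i \<in> I \<Longrightarrow> \<iota> i \<in> Arr C \<and> tdom (\<iota> i) = tdom (f i) \<and> tcod (\<iota> i) = P \<and> Cmp C \<pi> (\<iota> i) = f i"
      using cover_factors_through_coproduct[OF F(2) FA B] by metis
    have fS: "f i \<in> S" if "i \<in> I" for i using that I(2) F(1) by blast
    have P: "P \<in> K" using \<pi> by (auto simp: Arr_iff)
    have T: "(tdom \<circ> f) i \<in> K" if "i \<in> I" for i using \<iota>[OF that] by (auto simp: Arr_iff)
    have "x (f i) \<in> Sec X ((tdom \<circ> f) i)" if "i \<in> I" for i using x[OF fS[OF that]] by simp
    then obtain y where y: "y \<in> Sec X P" "\<And>i. i \<in> I \<Longrightarrow> Res X (\<iota> i) y = x (f i)"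
      using preserves_finite_products_glue[OF prod I(1) T coprod, of "\<lambda>i. x (f i)"] by blast
    \<comment> \<open>On arrows that factor through a summand, \<open>y\<close> restricts to the given section of the sieve.\<close>
    have factor: "Res X k y = x (Cmp C \<pi> k)"
      if i: "i \<in> I" and l: "l \<in> Arr C" "tcod l = tdom (\<iota> i)" and k: "k = Cmp C (\<iota> i) l" for k i l
    proof -
      have "Res X k y = Res X l (x (f i))"
        unfolding k using Res_Cmp[of l "\<iota> i" y] \<iota>[OF i] l y i by simp
      also have "\<dots> = x (Cmp C (f i) l)" using compat[OF fS[OF i] l(1)] \<iota>[OF i] l(2) by simp
      also have "Cmp C (f i) l = Cmp C \<pi> k"
        unfolding k using Cmp_assoc[of l "\<iota> i" \<pi>] \<iota>[OF i] l \<pi> by simp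
      finally show ?thesis .
    qed
    obtain W p q where pb: "is_pullback C \<pi> \<pi> W p q" using pullback_exists[OF \<pi>(1) \<pi>(1) refl] by metis
    have pq: "p \<in> Arr C" "tdom p = W" "tcod p = P" "q \<in> Arr C" "tdom q = W" "tcod q = P"
      "Cmp C \<pi> p = Cmp C \<pi> q"
      using pb \<pi>(2) by (auto simp: is_pullback_def hom_set_def)
    have \<iota>A: "\<iota> ` I \<subseteq> Arr C" using \<iota> by auto
    have "Res X p y = Res X q y"
    proof -
      obtain F1 where F1: "covers F1 W" "F1 \<subseteq> Arr C"
        "\<forall>w\<in>F1. \<exists>e\<in>\<iota> ` I. \<exists>h\<in>Arr C. tcod h = tdom e \<and> Cmp C p w = Cmp C e h"
        using refinement[OF P \<iota>_covers \<iota>A pq(1,3)] pq(2) by auto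
      show ?thesis
      proof (rule separated[OF _ F1(2,1)])
        show "W \<in> K" using pq by (auto simp: Arr_iff)
        show "Res X p y \<in> Sec X W" "Res X q y \<in> Sec X W"
          using Res_in_Sec[OF pq(1)] Res_in_Sec[OF pq(4)] pq y by auto
        fix w assume wF: "w \<in> F1"
        then have w: "w \<in> Arr C" "tcod w = W" using F1 by (auto simp: covers_def)
        obtain i g where i: "i \<in> I" and g: "g \<in> Arr C" "tcod g = tdom (\<iota> i)" "Cmp C p w = Cmp C (\<iota> i) g"
          using F1(3) wF by blast
        have qw: "Cmp C q w \<in> Arr C" "tcod (Cmp C q w) = P" using w pq by (auto intro: Cmp_Arr)
        \<comment> \<open>The family \<open>F1\<close> makes \<open>p\<close> factor through inclusions; \<open>F2\<close> does the same for \<open>q\<close> over a member of \<open>F1\<close>.\<close>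
        obtain F2 where F2: "covers F2 (tdom w)" "F2 \<subseteq> Arr C"
          "\<forall>v\<in>F2. \<exists>e\<in>\<iota> ` I. \<exists>h\<in>Arr C. tcod h = tdom e \<and> Cmp C (Cmp C q w) v = Cmp C e h"
          using refinement[OF P \<iota>_covers \<iota>A qw] by auto
        have pw_eq: "Res X w (Res X p y) = Res X (Cmp C p w) y" "Res X w (Res X q y) = Res X (Cmp C q w) y"
          using Res_Cmp[of w p y] Res_Cmp[of w q y] w pq y by auto
        have pw: "Cmp C p w \<in> Arr C" using w pq by (auto intro: Cmp_Arr)
        show "Res X w (Res X p y) = Res X w (Res X q y)"
          unfolding pw_eq
        proof (rule separated[OF _ F2(2,1)])
          show "tdom w \<in> K" using w by (auto simp: Arr_iff)
          show "Res X (Cmp C p w) y \<in> Sec X (tdom w)" "Res X (Cmp C q w) y \<in> Sec X (tdom w)"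
            using Res_in_Sec[OF pw] Res_in_Sec[OF qw(1)] pq y by auto
          fix v assume vF: "v \<in> F2"
          then have v: "v \<in> Arr C" "tcod v = tdom w" using F2 by (auto simp: covers_def)
          obtain j h where j: "j \<in> I" and h: "h \<in> Arr C" "tcod h = tdom (\<iota> j)"
              "Cmp C (Cmp C q w) v = Cmp C (\<iota> j) h"
            using F2(3) vF by blast
          have gd: "tdom g = tdom w" using arg_cong[OF g(3), of tdom] by simp
          have gv: "Cmp C g v \<in> Arr C" "tcod (Cmp C g v) = tdom (\<iota> i)"
            using g v gd by (auto intro: Cmp_Arr)
          have pwv: "Cmp C (Cmp C p w) v = Cmp C (\<iota> i) (Cmp C g v)"
            unfolding g(3) using Cmp_assoc[of v g "\<iota> i"] v g gd \<iota>[OF i] by simp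
          have wv: "Cmp C w v \<in> Arr C" using w v by (auto intro: Cmp_Arr)
          have "Cmp C \<pi> (Cmp C (Cmp C p w) v) = Cmp C (Cmp C \<pi> p) (Cmp C w v)"
            using Cmp_assoc[of v w p] Cmp_assoc[of "Cmp C w v" p \<pi>] v w pq \<pi> wv by simp
          also have "\<dots> = Cmp C \<pi> (Cmp C (Cmp C q w) v)"
            unfolding pq(7) using Cmp_assoc[of v w q] Cmp_assoc[of "Cmp C w v" q \<pi>] v w pq(4-6) \<pi> wv by simp
          finally have same: "Cmp C \<pi> (Cmp C (Cmp C p w) v) = Cmp C \<pi> (Cmp C (Cmp C q w) v)" .
          have "Res X v (Res X (Cmp C p w) y) = Res X (Cmp C (Cmp C p w) v) y"
            using Res_Cmp[of v "Cmp C p w" y] v pw pq y by simp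
          also have "\<dots> = x (Cmp C \<pi> (Cmp C (Cmp C p w) v))" by (rule factor[OF i gv pwv])
          also have "\<dots> = Res X (Cmp C (Cmp C q w) v) y"
            unfolding same by (rule factor[OF j h, symmetric])
          also have "\<dots> = Res X v (Res X (Cmp C q w) y)"
            using Res_Cmp[of v "Cmp C q w" y] v qw pq y by simp
          finally show "Res X v (Res X (Cmp C p w) y) = Res X v (Res X (Cmp C q w) y)" .
        qed
      qed
    qed
    then have "y \<in> {z \<in> Sec X P. Res X p z = Res X q z}" using y by simp
    then have "y \<in> Res X \<pi> ` Sec X B"
      using eq[OF \<pi>(1,4) pb] \<pi>(2,3) unfolding is_set_equalizer_def bij_betw_def by simp
    then obtain s where s: "s \<in> Sec X B" "Res X \<pi> s = y" by blast
    have "Res X k s = x k" if "k \<in> F" for k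
    proof -
      obtain i where i: "i \<in> I" "k = f i" using \<open>k \<in> F\<close> I(2) by blast
      then show ?thesis
        using Res_Cmp[of "\<iota> i" \<pi> s] \<iota>[OF i(1)] \<pi> s y(2)[OF i(1)] by simp
    qed
    then show "\<exists>F s. F \<subseteq> S \<and> covers F B \<and> s \<in> Sec X B \<and> (\<forall>f\<in>F. Res X f s = x f)"
      using F s by blast
  qed
qed

end

section \<open>Stonean spaces\<close>

definition stonean :: "'a topology \<Rightarrow> bool" where
  "stonean T \<longleftrightarrow> compact_space T \<and> Hausdorff_space T \<and> extremally_disconnected T"

lemma stonean_discrete: "finite A \<Longrightarrow> stonean (discrete_topology A)"
  by (simp add: stonean_def compact_space_discrete_topology extremally_disconnected_def
      closure_of_subset_topspace[of "discrete_topology A", simplified])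

lemma stonean_clopen_subtopology:
  assumes "stonean T" "openin T V" "closedin T V"
  shows "stonean (subtopology T V)"
  using assms
  by (simp add: stonean_def closedin_compact_space compact_space_subtopology Hausdorff_space_subtopology
      extremally_disconnected_clopen_subtopology)

locale stonean_category = full_category "{T :: 'a topology. stonean T}" +
  assumes infinite_points: "infinite (UNIV :: 'a set)"
begin

abbreviation K where "K \<equiv> {T :: 'a topology. stonean T}"

text \<open>Pull the family \<open>F\<close> back along \<open>g\<close> as one surjection from a compact Hausdorff space onto the
  source of \<open>g\<close>. This space need not be Stonean, but the surjection has a continuous section. The
  points whose value under the section comes from a given \<open>f\<close> form a clopen set, and the section
  yields the factorization of \<open>g\<close> through \<open>f\<close> on it.\<close>

lemma clopen_refinement:
  assumes F: "covers F B" "F \<subseteq> Arr C" and g: "g \<in> Arr C" "tcod g = B"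
  obtains I :: "nat set" and T \<iota> where "finite I" "\<And>i. i \<in> I \<Longrightarrow> T i \<in> K"
    "\<And>i. i \<in> I \<Longrightarrow> \<iota> i \<in> hom_set C (T i) (tdom g)"
    "topspace (tdom g) \<subseteq> (\<Union>i\<in>I. tfun (\<iota> i) ` topspace (T i))"
    "\<And>i j x y. \<lbrakk>i \<in> I; j \<in> I; x \<in> topspace (T i); y \<in> topspace (T j);
        tfun (\<iota> i) x = tfun (\<iota> j) y\<rbrakk> \<Longrightarrow> i = j \<and> x = y"
    "\<And>i. i \<in> I \<Longrightarrow> \<exists>f\<in>F. \<exists>h\<in>Arr C. tcod h = tdom f \<and> Cmp C g (\<iota> i) = Cmp C f h"
proof -
  let ?B = "tdom g" and ?S = "sum_topology tdom F"
  let ?ev = "\<lambda>(f, x). tfun f x"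
  have B: "?B \<in> K" "tcod g \<in> K" "continuous_map ?B (tcod g) (tfun g)" using g by (auto simp: Arr_iff)
  have fA: "f \<in> Arr C" "tcod f = tcod g" "tdom f \<in> K" "continuous_map (tdom f) (tcod g) (tfun f)"
    if "f \<in> F" for f
  proof -
    show "f \<in> Arr C" "tcod f = tcod g" using F g that by (auto simp: covers_def)
    then show "tdom f \<in> K" "continuous_map (tdom f) (tcod g) (tfun f)" unfolding Arr_iff by auto
  qed
  have S: "compact_space ?S" "Hausdorff_space ?S"
  proof -
    show "compact_space ?S"
      using F(1) fA(3) by (intro compact_space_sum_topology) (auto simp: covers_def stonean_def)
    show "Hausdorff_space ?S"
      using fA(3) by (intro Hausdorff_space_sum_topology) (auto simp: stonean_def)
  qed
  have ev: "continuous_map ?S (tcod g) ?ev"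
    by (rule continuous_map_sum_topology) (simp add: fA(4))
  have CH: "compact_space ?B" "compact_space ?S" "Hausdorff_space ?B" "Hausdorff_space ?S"
    "Hausdorff_space (tcod g)"
    using B S by (auto simp: stonean_def)
  define E where "E = subtopology (prod_topology ?B ?S) {(b, z). tfun g b = ?ev z}"
  note E = compact_Hausdorff_fibre_product[OF CH B(3) ev, folded E_def]
  have surj: "fst ` topspace E = topspace ?B"
  proof
    show "fst ` topspace E \<subseteq> topspace ?B" using E(5) by auto
    show "topspace ?B \<subseteq> fst ` topspace E"
    proof
      fix b assume b: "b \<in> topspace ?B"
      then have "tfun g b \<in> topspace B" using g tfun_in_topspace by blast
      then obtain f x where "f \<in> F" "x \<in> topspace (tdom f)" "tfun g b = tfun f x"
        using F(1) unfolding covers_def by blast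
      then have "(b, (f, x)) \<in> topspace E" using b E(5) by simp
      then show "b \<in> fst ` topspace E" by force
    qed
  qed
  obtain s where s: "continuous_map ?B E s" "\<And>b. b \<in> topspace ?B \<Longrightarrow> fst (s b) = b"
    using extremally_disconnected_section[OF E(1,2) CH(3) _ E(3) surj] B(1) by (auto simp: stonean_def)
  \<comment> \<open>\<open>r b = (f, x)\<close> says that the section picks the point \<open>x\<close> of the source of \<open>f\<close> over \<open>g b\<close>.\<close>
  define r where "r = snd \<circ> s"
  have r: "continuous_map ?B ?S r" unfolding r_def by (rule continuous_map_compose[OF s(1) E(4)])
  have gr: "tfun g b = tfun (fst (r b)) (snd (r b))" if "b \<in> topspace ?B" for b
  proof -
    have "s b \<in> topspace E" using s(1) that continuous_map_image_subset_topspace by blast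
    then show ?thesis using E(5) s(2)[OF that] by (auto simp: r_def case_prod_unfold)
  qed
  have rS: "fst (r b) \<in> F" "snd (r b) \<in> topspace (tdom (fst (r b)))" if "b \<in> topspace ?B" for b
  proof -
    have "r b \<in> topspace ?S" using r that continuous_map_image_subset_topspace by blast
    then show "fst (r b) \<in> F" "snd (r b) \<in> topspace (tdom (fst (r b)))" by (cases "r b", simp)+
  qed
  define V where "V f = {b \<in> topspace ?B. r b \<in> Pair f ` topspace (tdom f)}" for f
  have V_iff: "b \<in> V f \<longleftrightarrow> b \<in> topspace ?B \<and> fst (r b) = f" for b f
    using rS[of b] by (cases "r b") (auto simp: V_def)
  have V: "openin ?B (V f)" "closedin ?B (V f)" if "f \<in> F" for f
  proof -
    have "openin ?S (Pair f ` topspace (tdom f))" "closedin ?S (Pair f ` topspace (tdom f))"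
      using open_map_component_injection[OF that, of tdom] closed_map_component_injection[OF that, of tdom]
      by (auto simp: open_map_def closed_map_def)
    then show "openin ?B (V f)" "closedin ?B (V f)"
      unfolding V_def using r openin_continuous_map_preimage closedin_continuous_map_preimage by blast+
  qed
  obtain n :: nat and f where f: "F = f ` {i. i < n}" "inj_on f {i. i < n}"
    using F(1) finite_imp_nat_seg_image_inj_on unfolding covers_def by metis
  let ?I = "{i. i < n}"
  have fF: "f i \<in> F" if "i \<in> ?I" for i using f(1) that by blast
  define T where "T i = subtopology ?B (V (f i))" for i
  define \<iota> where "\<iota> i = mk_map (T i) ?B (\<lambda>x. x)" for i
  have topT: "topspace (T i) = V (f i)" for i
    unfolding T_def by (auto simp: V_iff)
  have T: "T i \<in> K" if "i \<in> ?I" for i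
    unfolding T_def using B(1) V[OF fF[OF that]] stonean_clopen_subtopology by blast
  have \<iota>: "\<iota> i \<in> hom_set C (T i) ?B" if "i \<in> ?I" for i
    unfolding \<iota>_def using T[OF that] B(1)
    by (intro mk_map_hom) (auto simp: T_def intro: continuous_map_from_subtopology)
  have \<iota>_eq: "tfun (\<iota> i) x = x" if "x \<in> topspace (T i)" for i x
    using that by (simp add: \<iota>_def)
  show ?thesis
  proof (rule that[of ?I T \<iota>])
    show "topspace ?B \<subseteq> (\<Union>i\<in>?I. tfun (\<iota> i) ` topspace (T i))"
    proof
      fix b assume b: "b \<in> topspace ?B"
      then obtain i where i: "i \<in> ?I" "fst (r b) = f i" using rS(1)[OF b] f(1) by blast
      then have "b \<in> topspace (T i)" using b by (simp add: topT V_iff)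
      then have "b \<in> tfun (\<iota> i) ` topspace (T i)" using \<iota>_eq[of b i] by (metis imageI)
      then show "b \<in> (\<Union>i\<in>?I. tfun (\<iota> i) ` topspace (T i))" using i by blast
    qed
    fix i assume i: "i \<in> ?I"
    show "\<exists>f\<in>F. \<exists>h\<in>Arr C. tcod h = tdom f \<and> Cmp C g (\<iota> i) = Cmp C f h"
    proof (intro bexI conjI)
      let ?f = "f i" and ?h = "mk_map (T i) (tdom (f i)) (\<lambda>b. snd (r b))"
      note fi = fA[OF fF[OF i]]
      have "continuous_map (T i) (tdom ?f) (\<lambda>b. snd (r b))"
        unfolding continuous_map
      proof (intro conjI allI impI)
        show "(\<lambda>b. snd (r b)) ` topspace (T i) \<subseteq> topspace (tdom ?f)"
        proof (intro image_subsetI)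
          fix b assume "b \<in> topspace (T i)"
          then have "b \<in> topspace ?B" "fst (r b) = ?f" by (auto simp: topT V_iff)
          then show "snd (r b) \<in> topspace (tdom ?f)" using rS(2)[of b] by simp
        qed
        fix U assume U: "openin (tdom ?f) U"
        have "{b \<in> topspace (T i). snd (r b) \<in> U} = {b \<in> topspace ?B. r b \<in> Pair ?f ` U}"
        proof (intro Collect_cong)
          fix b show "b \<in> topspace (T i) \<and> snd (r b) \<in> U \<longleftrightarrow> b \<in> topspace ?B \<and> r b \<in> Pair ?f ` U"
            unfolding topT V_iff by (cases "r b") auto
        qed
        moreover have "openin ?B {b \<in> topspace ?B. r b \<in> Pair ?f ` U}"
          using open_map_component_injection[OF fF[OF i], of tdom] U r
          by (intro openin_continuous_map_preimage[of _ ?S]) (auto simp: open_map_def)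
        ultimately show "openin (T i) {b \<in> topspace (T i). snd (r b) \<in> U}"
          using V[OF fF[OF i]] by (simp add: T_def openin_open_subtopology) (auto simp: V_iff)
      qed
      then show h: "?h \<in> Arr C" using T[OF i] fi by (intro mk_map_Arr)
      show "tcod ?h = tdom ?f" by simp
      show "?f \<in> F" using fF[OF i] .
      show "Cmp C g (\<iota> i) = Cmp C ?f ?h"
      proof (rule Arr_eqI)
        fix x assume "x \<in> topspace (tdom (Cmp C g (\<iota> i)))"
        then have x: "x \<in> topspace (T i)" by (simp add: \<iota>_def)
        then have "x \<in> topspace ?B" "fst (r x) = ?f" by (auto simp: topT V_iff)
        then show "tfun (Cmp C g (\<iota> i)) x = tfun (Cmp C ?f ?h) x"
          using x gr[of x] by (simp add: \<iota>_def)
      next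
        show "Cmp C g (\<iota> i) \<in> Arr C" using \<iota>[OF i] g by (intro Cmp_Arr) (auto simp: hom_set_def)
        show "Cmp C ?f ?h \<in> Arr C" using h fi by (intro Cmp_Arr) auto
        show "tdom (Cmp C g (\<iota> i)) = tdom (Cmp C ?f ?h)" by (simp add: \<iota>_def)
        show "tcod (Cmp C g (\<iota> i)) = tcod (Cmp C ?f ?h)" using fi by simp
      qed
    qed
  next
    fix i j x y assume ij: "i \<in> ?I" "j \<in> ?I" and xy: "x \<in> topspace (T i)" "y \<in> topspace (T j)"
      and "tfun (\<iota> i) x = tfun (\<iota> j) y"
    then have "x = y" using \<iota>_eq by metis
    then have "f i = f j" using xy by (simp add: topT V_iff)
    then show "i = j \<and> x = y" using f(2) ij \<open>x = y\<close> by (simp add: inj_on_eq_iff)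
  qed (use T \<iota> in auto)
qed

lemma separating_arrows:
  assumes B: "B \<in> K" and A: "closedin B A" and b: "b \<in> topspace B" "b \<notin> A"
  shows "\<exists>W\<in>K. \<exists>u v. continuous_map B W u \<and> continuous_map B W v \<and> (\<forall>a\<in>A. u a = v a) \<and> u b \<noteq> v b"
proof -
  obtain U where U: "openin B U" "closedin B U" "b \<in> U" "U \<inter> A = {}"
    using clopen_separation_extremally_disconnected[OF _ _ _ A b] B by (auto simp: stonean_def)
  obtain a0 a1 :: 'a where ab: "a0 \<noteq> a1"
    using infinite_two_points[OF infinite_points] by blast
  have "discrete_topology {a0, a1} \<in> K" by (simp add: stonean_discrete)
  then show ?thesis using clopen_separating_maps[OF U ab] by blast
qed

end

sublocale stonean_category \<subseteq> compact_Hausdorff_category K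
proof unfold_locales
  show "discrete_topology A \<in> K" if "finite A" for A :: "'a set"
    using that by (simp add: stonean_discrete)
  show "\<exists>a b :: 'a. a \<noteq> b"
    using infinite_two_points[OF infinite_points] by blast
  show "compact_space T" "Hausdorff_space T" if "T \<in> K" for T
    using that by (auto simp: stonean_def)
  show "\<exists>W\<in>K. \<exists>u v. continuous_map B W u \<and> continuous_map B W v \<and> (\<forall>a\<in>A. u a = v a) \<and> u b \<noteq> v b"
    if "B \<in> K" "closedin B A" "b \<in> topspace B" "b \<notin> A" for B A b
    using that by (rule separating_arrows)
  show "\<exists>F'. covers F' (tdom g) \<and> F' \<subseteq> Arr C \<and>
      (\<forall>f'\<in>F'. \<exists>f\<in>F. \<exists>h\<in>Arr C. tcod h = tdom f \<and> Cmp C g f' = Cmp C f h)"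
    if F: "covers F B" "F \<subseteq> Arr C" "g \<in> Arr C" "tcod g = B" for B F g
  proof (rule clopen_refinement[OF F])
    fix I :: "nat set" and T \<iota>
    assume I: "finite I"
      and \<iota>: "\<And>i. i \<in> I \<Longrightarrow> \<iota> i \<in> hom_set C (T i) (tdom g)"
      and surj: "topspace (tdom g) \<subseteq> (\<Union>i\<in>I. tfun (\<iota> i) ` topspace (T i))"
      and factor: "\<And>i. i \<in> I \<Longrightarrow> \<exists>f\<in>F. \<exists>h\<in>Arr C. tcod h = tdom f \<and> Cmp C g (\<iota> i) = Cmp C f h"
    have \<iota>A: "\<iota> i \<in> Arr C" "tdom (\<iota> i) = T i" "tcod (\<iota> i) = tdom g" if "i \<in> I" for i
      using \<iota>[OF that] by (auto simp: hom_set_def)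
    have "covers (\<iota> ` I) (tdom g)" unfolding covers_def using I surj \<iota>A by auto
    then show ?thesis using \<iota>A factor by (intro exI[of _ "\<iota> ` I"]) auto
  qed
qed

context stonean_category
begin

text \<open>The case where \<open>g\<close> is the identity: every sieve containing a finite jointly surjective family
  contains the inclusions of a coproduct decomposition of \<open>B\<close>.\<close>

lemma clopen_coproduct_in_cover:
  assumes F: "covers F B" "F \<subseteq> Arr C" and B: "B \<in> K"
  obtains I :: "nat set" and T \<iota> where "finite I" "\<And>i. i \<in> I \<Longrightarrow> T i \<in> K" "is_coproduct C I T B \<iota>"
    "covers (\<iota> ` I) B" "\<And>i. i \<in> I \<Longrightarrow> \<exists>f\<in>F. \<exists>h\<in>Arr C. tcod h = tdom f \<and> \<iota> i = Cmp C f h"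
proof -
  let ?id = "Ident C B"
  have id: "?id \<in> Arr C" "tcod ?id = B" "tdom ?id = B" using Ident_Arr[of B] B by auto
  show ?thesis
  proof (rule clopen_refinement[OF F id(1,2), unfolded id(3)])
    fix I :: "nat set" and T \<iota>
    assume I: "finite I" and T: "\<And>i. i \<in> I \<Longrightarrow> T i \<in> K"
      and \<iota>: "\<And>i. i \<in> I \<Longrightarrow> \<iota> i \<in> hom_set C (T i) B"
      and surj: "topspace B \<subseteq> (\<Union>i\<in>I. tfun (\<iota> i) ` topspace (T i))"
      and inj: "\<And>i j x y. \<lbrakk>i \<in> I; j \<in> I; x \<in> topspace (T i); y \<in> topspace (T j);
          tfun (\<iota> i) x = tfun (\<iota> j) y\<rbrakk> \<Longrightarrow> i = j \<and> x = y"
      and factor: "\<And>i. i \<in> I \<Longrightarrow> \<exists>f\<in>F. \<exists>h\<in>Arr C. tcod h = tdom f \<and> Cmp C ?id (\<iota> i) = Cmp C f h"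
    have \<iota>A: "\<iota> i \<in> Arr C" "tdom (\<iota> i) = T i" "tcod (\<iota> i) = B" if "i \<in> I" for i
      using \<iota>[OF that] by (auto simp: hom_set_def)
    show thesis
    proof (rule that[OF I T])
      show "is_coproduct C I T B \<iota>" by (rule coproductI[OF I B T \<iota> surj inj])
      show "covers (\<iota> ` I) B" unfolding covers_def using I surj \<iota>A by auto
      show "\<exists>f\<in>F. \<exists>h\<in>Arr C. tcod h = tdom f \<and> \<iota> i = Cmp C f h" if "i \<in> I" for i
        using factor[OF that] Ident_Cmp[of "\<iota> i"] \<iota>A[OF that] by simp
    qed
  qed
qed

lemma is_sheaf_if_products:
  assumes X: "is_presheaf C X" and prod: "preserves_finite_products C X"
  shows "is_sheaf C (coherent_topology C) X"
proof (rule is_sheafI[OF X])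
  interpret presheaf C X by unfold_locales (fact X)
  fix F B x y
  assume B: "B \<in> K" and F: "F \<subseteq> Arr C" "covers F B" and xy: "x \<in> Sec X B" "y \<in> Sec X B"
    and res: "\<And>f. f \<in> F \<Longrightarrow> Res X f x = Res X f y"
  obtain I :: "nat set" and T \<iota> where I: "finite I" and T: "\<And>i. i \<in> I \<Longrightarrow> T i \<in> K"
    and coprod: "is_coproduct C I T B \<iota>" and "covers (\<iota> ` I) B"
    and factor: "\<And>i. i \<in> I \<Longrightarrow> \<exists>f\<in>F. \<exists>h\<in>Arr C. tcod h = tdom f \<and> \<iota> i = Cmp C f h"
    using clopen_coproduct_in_cover[OF F(2,1) B] by metis
  show "x = y"
  proof (rule preserves_finite_products_eqI[OF prod I T coprod xy])
    fix i assume "i \<in> I"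
    then obtain f h where fh: "f \<in> F" "h \<in> Arr C" "tcod h = tdom f" "\<iota> i = Cmp C f h"
      using factor by blast
    have f: "f \<in> Arr C" "tcod f = B" using fh(1) F by (auto simp: covers_def)
    show "Res X (\<iota> i) x = Res X (\<iota> i) y"
      unfolding fh(4) using Res_Cmp[of h f] fh f xy res by simp
  qed
next
  fix S B x
  assume B: "B \<in> K" and S: "S \<in> covering_sieves B"
    and x: "\<And>f. f \<in> S \<Longrightarrow> x f \<in> Sec X (tdom f)"
  from S obtain F where sieve: "is_sieve C B S" and F: "F \<subseteq> S" "covers F B"
    by (auto simp: covering_sieves_def)
  have FA: "F \<subseteq> Arr C" using F sieve_Arr[OF sieve] by blast
  obtain I :: "nat set" and T \<iota> where I: "finite I" and T: "\<And>i. i \<in> I \<Longrightarrow> T i \<in> K"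
    and coprod: "is_coproduct C I T B \<iota>" and cov: "covers (\<iota> ` I) B"
    and factor: "\<And>i. i \<in> I \<Longrightarrow> \<exists>f\<in>F. \<exists>h\<in>Arr C. tcod h = tdom f \<and> \<iota> i = Cmp C f h"
    using clopen_coproduct_in_cover[OF F(2) FA B] by metis
  have \<iota>S: "\<iota> i \<in> S" if "i \<in> I" for i
  proof -
    obtain f h where "f \<in> F" "h \<in> Arr C" "tcod h = tdom f" "\<iota> i = Cmp C f h"
      using factor[OF \<open>i \<in> I\<close>] by blast
    then show ?thesis using F(1) sieve unfolding is_sieve_def by auto
  qed
  have "tdom (\<iota> i) = T i" if "i \<in> I" for i
    using coprod that by (auto simp: is_coproduct_def hom_set_def)
  then have "x (\<iota> i) \<in> Sec X (T i)" if "i \<in> I" for i using x[OF \<iota>S[OF that]] that by simp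
  then obtain s where "s \<in> Sec X B" "\<And>i. i \<in> I \<Longrightarrow> Res X (\<iota> i) s = x (\<iota> i)"
    using preserves_finite_products_glue[OF prod I T coprod, of "\<lambda>i. x (\<iota> i)"] by blast
  then show "\<exists>F s. F \<subseteq> S \<and> covers F B \<and> s \<in> Sec X B \<and> (\<forall>f\<in>F. Res X f s = x f)"
    using \<iota>S cov by (intro exI[of _ "\<iota> ` I"] exI[of _ s]) auto
qed

end

section \<open>The sheaf conditions\<close>

theorem theorem7p4:
  assumes "infinite (UNIV :: 'a set)"
  shows "(\<forall>C \<in> {CompHaus, Profinite}.
            \<forall>X :: ('a topology, 'a tmap, 'b) presheaf_data. is_presheaf C X \<longrightarrow>
              (is_sheaf C (coherent_topology C) X \<longleftrightarrow>
                 preserves_finite_products C X \<and> surjections_give_equalizers C X)) \<and>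
         (\<forall>X :: ('a topology, 'a tmap, 'b) presheaf_data. is_presheaf Stonean X \<longrightarrow>
              (is_sheaf Stonean (coherent_topology Stonean) X \<longleftrightarrow>
                 preserves_finite_products Stonean X))"
proof -
  have comp_haus: "is_sheaf (full_Top {T. comp_haus td T}) (coherent_topology (full_Top {T. comp_haus td T})) X \<longleftrightarrow>
      preserves_finite_products (full_Top {T. comp_haus td T}) X \<and>
      surjections_give_equalizers (full_Top {T. comp_haus td T}) X"
    if "is_presheaf (full_Top {T. comp_haus td T}) X"
    for td and X :: "('a topology, 'a tmap, 'b) presheaf_data"
  proof -
    interpret comp_haus_category td
      by (rule comp_haus_category.intro[OF full_category], unfold_locales) (fact assms)
    show ?thesis
      using sheaf_preserves_finite_products[OF that] sheaf_equalizers[OF that]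
        is_sheaf_if_products_and_equalizers[OF that] by blast
  qed
  interpret S: stonean_category
    by (rule stonean_category.intro[OF full_category], unfold_locales) (fact assms)
  have Stonean_eq: "Stonean = full_Top {T :: 'a topology. stonean T}"
    by (simp add: Stonean_def stonean_def)
  show ?thesis
    using comp_haus[of False] comp_haus[of True] S.sheaf_preserves_finite_products S.is_sheaf_if_products
    unfolding CompHaus_eq Profinite_eq Stonean_eq by blast
qed

end
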